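(* Let $\mathbb{D}=\{z\in\mathbb{C}:|z|<1\}$ and let $\psi$ be a conformal map of $\mathbb{D}$ onto an unbounded simply connected domain $D\subset\mathbb{C}$. For $\alpha>0$, let $F_\alpha=\{z\in\mathbb{D}: |\psi(z)|=\alpha\}$. If $0<p<+\infty$, then $$\psi\in H^p(\mathbb{D}) \iff \int_0^{+\infty}\alpha^{p-1}e^{-d_{\mathbb{D}}(0,F_\alpha)}\,d\alpha<+\infty.$$
   Context: A conformal map of $\mathbb{D}$ onto a domain $D$ is an injective holomorphic function on $\mathbb{D}$ with image $D$. The hyperbolic distance between two points $z,w\in\mathbb{D}$ is $$d_{\mathbb{D}}(z,w)=\log\frac{1+\left|\frac{z-w}{1-z\bar w}\right|}{1-\left|\frac{z-w}{1-z\bar w}\right|}.$$ For a point $z\in\mathbb{D}$ and a set $E\subset\mathbb{D}$, $d_{\mathbb{D}}(z,E)=\inf\{d_{\mathbb{D}}(z,w): w\in E\}$, with the convention $\inf\emptyset=+\infty$ and $e^{-\infty}=0$ (the set $F_\alpha$ may be empty for some $\alpha$). For $0<p<+\infty$, the Hardy space is $$H^p(\mathbb{D})=\left\{f\in H(\mathbb{D}): \sup_{0<r<1}\int_0^{2\pi}|f(re^{i\theta})|^p\,d\theta<+\infty\right\},$$ where $H(\mathbb{D})$ is the family of all holomorphic functions on $\mathbb{D}$. *)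

theory Defs
  imports "HOL-Complex_Analysis.Complex_Analysis"
begin

abbreviation unit_disc :: "complex set"
  where "unit_disc \<equiv> ball 0 1"

definition conformal_map :: "(complex \<Rightarrow> complex) \<Rightarrow> complex set \<Rightarrow> bool"
  where "conformal_map \<psi> D \<longleftrightarrow>
    \<psi> holomorphic_on unit_disc \<and> inj_on \<psi> unit_disc \<and> \<psi> ` unit_disc = D"

definition hyp_dist :: "complex \<Rightarrow> complex \<Rightarrow> real"
  where "hyp_dist z w =
    ln ((1 + cmod ((z - w) / (1 - z * cnj w))) / (1 - cmod ((z - w) / (1 - z * cnj w))))"

text \<open>The distance to a set is extended-real valued, because the infimum over the empty set
  is \<open>\<infinity>\<close>.\<close>

definition hyp_dist_set :: "complex \<Rightarrow> complex set \<Rightarrow> ereal"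
  where "hyp_dist_set z E = (INF w\<in>E. ereal (hyp_dist z w))"

lemma hyp_dist_set_empty [simp]: "hyp_dist_set z {} = \<infinity>"
  by (simp add: hyp_dist_set_def top_ereal_def)

definition exp_ereal :: "ereal \<Rightarrow> ennreal"
  where "exp_ereal x = (case x of ereal r \<Rightarrow> ennreal (exp r) | PInfty \<Rightarrow> \<infinity> | MInfty \<Rightarrow> 0)"

lemma exp_ereal_simps [simp]:
  "exp_ereal (ereal r) = ennreal (exp r)"
  "exp_ereal \<infinity> = \<infinity>"
  "exp_ereal (- \<infinity>) = 0"
  unfolding exp_ereal_def MInfty_eq_minfinity[symmetric]
  unfolding PInfty_eq_infinity[symmetric]
  by (simp_all only: ereal.case)

text \<open>Membership in the Hardy space depends only on the values of the total function \<open>f\<close> on the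
  disc. The integrand is nonnegative and the supremum may be infinite, hence the
  \<open>ennreal\<close>-valued integral.\<close>

definition hardy_space :: "real \<Rightarrow> (complex \<Rightarrow> complex) set"
  where "hardy_space p = {f. f holomorphic_on unit_disc \<and>
    (SUP r\<in>{0<..<1::real}.
       \<integral>\<^sup>+\<theta>\<in>{0..2*pi}. ennreal (cmod (f (of_real r * exp (\<i> * of_real \<theta>))) powr p) \<partial>lborel) < \<infinity>}"

definition level_set :: "(complex \<Rightarrow> complex) \<Rightarrow> real \<Rightarrow> complex set"
  where "level_set \<psi> \<alpha> = {z \<in> unit_disc. cmod (\<psi> z) = \<alpha>}"

end

theory Submission
  imports Defs
begin

text \<open>
For a holomorphic function \<open>f\<close> on the disc let \<open>M r\<close> be the maximum of \<open>\<bar>f\<bar>\<close> on the closed disc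
of radius \<open>r\<close>, and let \<open>F\<^sub>\<alpha>\<close> be the set where \<open>\<bar>f\<bar> = \<alpha>\<close>. Both sides of the equivalence say
that \<open>M powr p\<close> is integrable over the radii \<open>0 < r < 1\<close>.

For the hyperbolic side this is elementary. One has \<open>exp (- d (0, w)) = (1 - \<bar>w\<bar>) / (1 + \<bar>w\<bar>)\<close>, so
\<open>exp (- d (0, F\<^sub>\<alpha>))\<close> is comparable with \<open>1 - \<bar>w\<bar>\<close> for the point \<open>w\<close> of \<open>F\<^sub>\<alpha>\<close> nearest to the
origin, that is, with the length of the set of radii where \<open>M r \<ge> \<alpha>\<close>. Integrating against
\<open>\<alpha> powr (p - 1)\<close> and exchanging the integrals gives the integral of \<open>M powr p / p\<close>; see
\<open>hyp_dist_integral_finite_iff\<close>. Levels below \<open>\<bar>f 0\<bar>\<close> are exceptional but contribute a finite amount.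

For the Hardy side (\<open>univalent_hardy_iff_max_modulus\<close>) subtract a constant so that \<open>f 0 = 0\<close>. As
\<open>f\<close> is injective, \<open>f z / z\<close> has no zeros, and \<open>h = (f z / z) powr (p / 2)\<close> is holomorphic with a
power series \<open>\<Sum>n. c n * z ^ n\<close>. By Parseval, \<open>f\<close> is in the Hardy space iff \<open>\<Sum>n. \<bar>c n\<bar>\<^sup>2\<close> is finite.

If that sum is finite, then \<open>M r powr p \<le> (\<Sum>n. \<bar>c n\<bar> * r ^ n)\<^sup>2\<close>, and Hilbert's inequality
bounds the integral of the right-hand side by \<open>pi * (\<Sum>n. \<bar>c n\<bar>\<^sup>2)\<close>.

Conversely, following Prawitz, consider the integral of \<open>\<bar>f\<bar> powr (p - 2) * \<bar>f'\<bar>\<^sup>2\<close> over the disc of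
radius \<open>r\<close>. It is a constant times \<open>\<Sum>n. (2 * n + p) * \<bar>c n\<bar>\<^sup>2 * r powr (2 * n + p)\<close> by Parseval again.
On the other hand, because \<open>f\<close> is injective, it is the integral of \<open>\<bar>w\<bar> powr (p - 2)\<close> over the image,
which is contained in the disc of radius \<open>M r\<close>, and so it is at most a constant times \<open>M r powr p\<close>.
Integrating this inequality over \<open>r\<close> removes the factor \<open>2 * n + p\<close> and bounds \<open>\<Sum>n. \<bar>c n\<bar>\<^sup>2\<close> by
the integral of \<open>M powr p\<close>.
\<close>

unbundle no fps_syntax

section \<open>Parseval's identity and Hilbert's inequality\<close>

lemma has_integral_cis:
  fixes m :: int
  shows "((\<lambda>\<theta>. cis (of_int m * \<theta>)) has_integral (if m = 0 then of_real (2*pi) else 0)) {0..2*pi}"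
proof (cases "m = 0")
  case True
  have "((\<lambda>\<theta>::real. 1::complex) has_integral (2*pi - 0) *\<^sub>R 1) {0..2*pi}"
    by (rule has_integral_const_real[THEN has_integral_eq_rhs]) simp
  with True show ?thesis by (simp add: scaleR_conv_of_real)
next
  case False
  have "((\<lambda>\<theta>. cis (of_int m * \<theta>)) has_integral
      (cis (of_int m * (2*pi)) / (\<i> * of_int m) - cis (of_int m * 0) / (\<i> * of_int m))) {0..2*pi}"
  proof (rule fundamental_theorem_of_calculus)
    fix x :: real
    show "((\<lambda>\<theta>. cis (of_int m * \<theta>) / (\<i> * of_int m)) has_vector_derivative cis (of_int m * x))
        (at x within {0..2*pi})"
      unfolding has_vector_derivative_def using False
      by (auto intro!: derivative_eq_intros simp: fun_eq_iff scaleR_conv_of_real field_simps)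
  qed auto
  moreover have "cis (of_int m * (2*pi)) = 1"
    using cis_multiple_2pi[of "of_int m"] by (simp add: mult_ac)
  ultimately show ?thesis using False by simp
qed

text \<open>The sawtooth \<open>\<theta> - pi\<close> has Fourier coefficients proportional to \<open>1 / m\<close>. Multiplying by it is what
produces the entries \<open>1 / (i + j + 1)\<close> of the Hilbert matrix out of a trigonometric polynomial.\<close>

lemma has_integral_sawtooth_cis:
  fixes m :: nat
  assumes "m > 0"
  shows "((\<lambda>\<theta>. of_real (\<theta> - pi) * cis (of_nat m * \<theta>)) has_integral (2*pi / (\<i> * of_nat m))) {0..2*pi}"
proof -
  let ?F = "\<lambda>\<theta>. of_real (\<theta> - pi) * cis (of_nat m * \<theta>) / (\<i> * of_nat m) + cis (of_nat m * \<theta>) / (of_nat m)^2"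
  have *: "((\<lambda>\<theta>. of_real (\<theta> - pi) * cis (of_nat m * \<theta>)) has_integral (?F (2*pi) - ?F 0)) {0..2*pi}"
  proof (rule fundamental_theorem_of_calculus)
    fix x :: real
    show "(?F has_vector_derivative of_real (x - pi) * cis (of_nat m * x))
        (at x within {0..2*pi})"
      unfolding has_vector_derivative_def using assms
      by (auto intro!: derivative_eq_intros simp: fun_eq_iff scaleR_conv_of_real field_simps power2_eq_square)
  qed auto
  moreover have "cis (of_nat m * (2*pi)) = 1"
    using cis_multiple_2pi[of "of_nat m"] by (simp add: mult_ac)
  ultimately have "?F (2*pi) - ?F 0 = 2*pi / (\<i> * of_nat m)"
    using assms by (simp add: field_simps)
  with * show ?thesis by simp
qed

lemma norm_sum_squared_expand:
  fixes c :: "nat \<Rightarrow> complex"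
  shows "complex_of_real ((cmod (\<Sum>n<N. c n * (of_real \<rho> * cis \<theta>) ^ n))\<^sup>2)
    = (\<Sum>i<N. \<Sum>j<N. c i * cnj (c j) * of_real (\<rho> ^ (i + j)) * cis (of_int (int i - int j) * \<theta>))"
proof -
  have "complex_of_real ((cmod (\<Sum>n<N. c n * (of_real \<rho> * cis \<theta>) ^ n))\<^sup>2)
     = (\<Sum>n<N. c n * (of_real \<rho> * cis \<theta>) ^ n) * cnj (\<Sum>n<N. c n * (of_real \<rho> * cis \<theta>) ^ n)"
    by (simp only: complex_norm_square)
  also have "\<dots> = (\<Sum>i<N. \<Sum>j<N. (c i * (of_real \<rho> * cis \<theta>) ^ i) * cnj (c j * (of_real \<rho> * cis \<theta>) ^ j))"
    by (simp add: cnj_sum sum_product)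
  also have "\<dots> = (\<Sum>i<N. \<Sum>j<N. c i * cnj (c j) * of_real (\<rho> ^ (i + j)) * cis (of_int (int i - int j) * \<theta>))"
  proof (intro sum.cong refl)
    fix i j
    have "cis (of_int (int i - int j) * \<theta>) = cis (real i * \<theta>) * cis (- (real j * \<theta>))"
      by (simp add: cis_mult algebra_simps)
    also have "\<dots> = cis \<theta> ^ i * cnj (cis \<theta> ^ j)"
      by (simp only: Complex.DeMoivre complex_cnj_power cis_cnj mult_minus_right)
    finally have "cis (of_int (int i - int j) * \<theta>) = cis \<theta> ^ i * cnj (cis \<theta> ^ j)" .
    then show "(c i * (of_real \<rho> * cis \<theta>) ^ i) * cnj (c j * (of_real \<rho> * cis \<theta>) ^ j)
      = c i * cnj (c j) * of_real (\<rho> ^ (i + j)) * cis (of_int (int i - int j) * \<theta>)"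
      by (simp add: power_mult_distrib power_add)
  qed
  finally show ?thesis .
qed

lemma parseval_polynomial:
  fixes c :: "nat \<Rightarrow> complex"
  shows "((\<lambda>\<theta>. (cmod (\<Sum>n<N. c n * (of_real \<rho> * cis \<theta>) ^ n))\<^sup>2) has_integral
     2 * pi * (\<Sum>n<N. (cmod (c n))\<^sup>2 * \<rho> ^ (2 * n))) {0..2*pi}"
proof -
  have "((\<lambda>\<theta>. complex_of_real ((cmod (\<Sum>n<N. c n * (of_real \<rho> * cis \<theta>) ^ n))\<^sup>2)) has_integral
     (\<Sum>i<N. \<Sum>j<N. c i * cnj (c j) * of_real (\<rho> ^ (i + j)) *
        (if int i - int j = 0 then of_real (2*pi) else 0))) {0..2*pi}"
    unfolding norm_sum_squared_expand
    by (intro has_integral_sum finite_lessThan has_integral_mult_right has_integral_cis)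
  moreover have "(\<Sum>i<N. \<Sum>j<N. c i * cnj (c j) * of_real (\<rho> ^ (i + j)) *
        (if int i - int j = 0 then of_real (2*pi) else 0)) =
      complex_of_real (2 * pi * (\<Sum>n<N. (cmod (c n))\<^sup>2 * \<rho> ^ (2 * n)))"
  proof -
    have "(\<Sum>j<N. c i * cnj (c j) * of_real (\<rho> ^ (i + j)) * (if int i - int j = 0 then of_real (2*pi) else 0))
       = complex_of_real (2 * pi * ((cmod (c i))\<^sup>2 * \<rho> ^ (2 * i)))" if "i < N" for i
    proof -
      have "(\<Sum>j<N. c i * cnj (c j) * of_real (\<rho> ^ (i + j)) * (if int i - int j = 0 then of_real (2*pi) else 0))
        = (\<Sum>j<N. if j = i then c i * cnj (c i) * of_real (\<rho> ^ (i + i)) * of_real (2*pi) else 0)"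
        by (intro sum.cong refl) auto
      also have "\<dots> = complex_of_real ((cmod (c i))\<^sup>2) * of_real (\<rho> ^ (i + i)) * of_real (2*pi)"
        unfolding complex_norm_square using that by (simp add: sum.delta)
      also have "\<dots> = complex_of_real (2 * pi * ((cmod (c i))\<^sup>2 * \<rho> ^ (2 * i)))"
        by (simp flip: mult_2)
      finally show ?thesis .
    qed
    then show ?thesis unfolding sum_distrib_left of_real_sum by (intro sum.cong refl) auto
  qed
  ultimately have "((\<lambda>\<theta>. complex_of_real ((cmod (\<Sum>n<N. c n * (of_real \<rho> * cis \<theta>) ^ n))\<^sup>2)) has_integral
     complex_of_real (2 * pi * (\<Sum>n<N. (cmod (c n))\<^sup>2 * \<rho> ^ (2 * n)))) {0..2*pi}"
    by (simp only:)
  from has_integral_Re[OF this] show ?thesis by (simp only: Re_complex_of_real)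
qed

text \<open>Hilbert's inequality with its constant \<open>pi\<close>. The quadratic form is, up to the factor \<open>2 * pi / \<i>\<close>,
the integral of \<open>(\<theta> - pi) * cis \<theta> * P \<theta> ^ 2\<close> over a period, where \<open>P\<close> is the trigonometric
polynomial with coefficients \<open>a\<close>; as \<open>\<bar>\<theta> - pi\<bar> \<le> pi\<close>, Parseval's identity bounds it.\<close>

lemma hilbert_inequality_polynomial:
  fixes a :: "nat \<Rightarrow> real"
  shows "((\<lambda>x. (\<Sum>n<N. a n * x ^ n)\<^sup>2) has_integral (\<Sum>i<N. \<Sum>j<N. a i * a j / (i + j + 1))) {0..1}"
    and "(\<Sum>i<N. \<Sum>j<N. a i * a j / (i + j + 1)) \<le> pi * (\<Sum>n<N. (a n)\<^sup>2)"
proof -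
  have *: "((\<lambda>x::real. x ^ k) has_integral (1 / real (k + 1))) {0..1}" for k :: nat
  proof -
    have "((\<lambda>x::real. x ^ k) has_integral (1 ^ Suc k / Suc k - 0 ^ Suc k / Suc k)) {0..1}"
      by (rule fundamental_theorem_of_calculus)
         (auto intro!: derivative_eq_intros simp flip: has_real_derivative_iff_has_vector_derivative simp del: power_Suc)
    then show ?thesis by simp
  qed
  have "((\<lambda>x. \<Sum>i<N. \<Sum>j<N. a i * a j * x ^ (i + j)) has_integral (\<Sum>i<N. \<Sum>j<N. a i * a j * (1 / (i + j + 1)))) {0..1}"
    by (intro has_integral_sum finite_lessThan has_integral_mult_right *)
  then show "((\<lambda>x. (\<Sum>n<N. a n * x ^ n)\<^sup>2) has_integral (\<Sum>i<N. \<Sum>j<N. a i * a j / (i + j + 1))) {0..1}"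
    by (simp only: power2_eq_square sum_product power_add mult_ac times_divide_eq_right mult_1_left mult_1_right)
next
  let ?P = "\<lambda>\<theta>. \<Sum>n<N. of_real (a n) * cis \<theta> ^ n"
  let ?A = "\<Sum>i<N. \<Sum>j<N. a i * a j / (i + j + 1)"
  have "((\<lambda>\<theta>. \<Sum>i<N. \<Sum>j<N. of_real (a i * a j) * (of_real (\<theta> - pi) * cis (of_nat (i + j + 1) * \<theta>))) has_integral
       (\<Sum>i<N. \<Sum>j<N. of_real (a i * a j) * (2*pi / (\<i> * of_nat (i + j + 1))))) {0..2*pi}"
    by (intro has_integral_sum finite_lessThan has_integral_mult_right has_integral_sawtooth_cis) auto
  also have "(\<lambda>\<theta>. \<Sum>i<N. \<Sum>j<N. of_real (a i * a j) * (of_real (\<theta> - pi) * cis (of_nat (i + j + 1) * \<theta>)))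
      = (\<lambda>\<theta>. of_real (\<theta> - pi) * cis \<theta> * (?P \<theta>)\<^sup>2)"
    unfolding power2_eq_square sum_product unfolding sum_distrib_left
  proof (intro ext sum.cong refl)
    fix \<theta> i j
    have "cis (of_nat (i + j + 1) * \<theta>) = cis \<theta> * (cis \<theta> ^ i * cis \<theta> ^ j)"
      by (simp only: flip: Complex.DeMoivre) (simp add: power_add)
    then show "of_real (a i * a j) * (of_real (\<theta> - pi) * cis (of_nat (i + j + 1) * \<theta>))
       = of_real (\<theta> - pi) * cis \<theta> * (of_real (a i) * cis \<theta> ^ i * (of_real (a j) * cis \<theta> ^ j))"
      by simp
  qed
  also have "(\<Sum>i<N. \<Sum>j<N. of_real (a i * a j) * (2*pi / (\<i> * of_nat (i + j + 1)))) = 2 * pi / \<i> * complex_of_real ?A"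
    unfolding of_real_sum sum_distrib_left
    by (intro sum.cong refl) (simp add: field_simps del: of_nat_add of_nat_Suc)
  finally have 1: "((\<lambda>\<theta>. of_real (\<theta> - pi) * cis \<theta> * (?P \<theta>)\<^sup>2) has_integral 2 * pi / \<i> * complex_of_real ?A) {0..2*pi}" .
  have 2: "((\<lambda>\<theta>. pi * (cmod (?P \<theta>))\<^sup>2) has_integral pi * (2 * pi * (\<Sum>n<N. (a n)\<^sup>2))) {0..2*pi}"
    using has_integral_mult_right[OF parseval_polynomial[of "\<lambda>n. of_real (a n)" 1 N], of pi] by simp
  have "cmod (2 * pi / \<i> * complex_of_real ?A) \<le> pi * (2 * pi * (\<Sum>n<N. (a n)\<^sup>2))"
    unfolding integral_unique[OF 1, symmetric] integral_unique[OF 2, symmetric]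
  proof (rule integral_norm_bound_integral)
    fix \<theta> :: real assume "\<theta> \<in> {0..2*pi}"
    then have "\<bar>\<theta> - pi\<bar> \<le> pi" by auto
    then show "cmod (of_real (\<theta> - pi) * cis \<theta> * (?P \<theta>)\<^sup>2) \<le> pi * (cmod (?P \<theta>))\<^sup>2"
      by (simp only: norm_mult norm_of_real norm_cis norm_power mult_1_right) (rule mult_right_mono; simp)
  qed (use 1 2 in auto)
  then have "2 * pi * \<bar>?A\<bar> \<le> 2 * pi * (pi * (\<Sum>n<N. (a n)\<^sup>2))"
    by (simp add: norm_mult norm_divide del: of_real_sum)
  then show "?A \<le> pi * (\<Sum>n<N. (a n)\<^sup>2)"
    by simp
qed

text \<open>Stating the identity in \<open>ennreal\<close> lets both sides be infinite in the limit \<open>\<rho> \<longrightarrow> 1\<close>, which is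
how it decides membership in a Hardy space.\<close>

lemma parseval_circle:
  fixes c :: "nat \<Rightarrow> complex"
  assumes h: "\<And>z. cmod z < 1 \<Longrightarrow> (\<lambda>n. c n * z ^ n) sums h z" and \<rho>: "0 \<le> \<rho>" "\<rho> < 1"
  shows "(\<integral>\<^sup>+\<theta>\<in>{0..2*pi}. ennreal ((cmod (h (of_real \<rho> * cis \<theta>)))\<^sup>2) \<partial>lborel)
    = ennreal (2 * pi) * (\<Sum>n. ennreal ((cmod (c n))\<^sup>2 * \<rho> ^ (2 * n)))"
proof -
  define S where "S N \<theta> = (\<Sum>n<N. c n * (of_real \<rho> * cis \<theta>) ^ n)" for N and \<theta> :: real
  have S_lim: "(\<lambda>N. S N \<theta>) \<longlonglongrightarrow> h (of_real \<rho> * cis \<theta>)" for \<theta>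
    using h[of "of_real \<rho> * cis \<theta>"] \<rho> by (simp add: S_def sums_def norm_mult)
  have S_meas [measurable]: "S N \<in> borel_measurable borel" for N
    unfolding S_def by (intro borel_measurable_continuous_onI continuous_intros)
  have h_meas [measurable]: "(\<lambda>\<theta>. h (of_real \<rho> * cis \<theta>)) \<in> borel_measurable borel"
    by (rule borel_measurable_LIMSEQ_metric[of S]) (use S_lim in auto)
  obtain x where x: "\<rho> < x" "x < 1" using dense \<rho> by blast
  have "summable (\<lambda>n. c n * of_real x ^ n)"
    using h[of "of_real x"] x \<rho> by (auto simp: sums_iff)
  then have summ: "summable (\<lambda>n. cmod (c n * of_real \<rho> ^ n))"
    by (rule powser_insidea) (use x \<rho> in auto)
  define B where "B = (\<Sum>n. cmod (c n * of_real \<rho> ^ n))"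
  have bound: "cmod (S N \<theta>) \<le> B" for N \<theta>
  proof -
    have "cmod (S N \<theta>) \<le> (\<Sum>n<N. cmod (c n * of_real \<rho> ^ n))"
      unfolding S_def by (rule sum_norm_le) (simp add: norm_mult norm_power)
    also have "\<dots> \<le> B" unfolding B_def by (rule sum_le_suminf[OF summ]) auto
    finally show ?thesis .
  qed
  have lim_int: "(\<lambda>N. \<integral>\<^sup>+\<theta>\<in>{0..2*pi}. ennreal ((cmod (S N \<theta>))\<^sup>2) \<partial>lborel)
     \<longlonglongrightarrow> (\<integral>\<^sup>+\<theta>\<in>{0..2*pi}. ennreal ((cmod (h (of_real \<rho> * cis \<theta>)))\<^sup>2) \<partial>lborel)"
  proof (rule nn_integral_dominated_convergence[where w="\<lambda>\<theta>. ennreal (B\<^sup>2) * indicator {0..2*pi} \<theta>"])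
    show "AE \<theta> in lborel. ennreal ((cmod (S N \<theta>))\<^sup>2) * indicator {0..2*pi} \<theta>
        \<le> ennreal (B\<^sup>2) * indicator {0..2*pi} \<theta>" for N
      by (intro AE_I2 mult_right_mono ennreal_leI power_mono bound) auto
    show "(\<integral>\<^sup>+\<theta>. ennreal (B\<^sup>2) * indicator {0..2*pi} \<theta> \<partial>lborel) < \<infinity>"
      by (simp add: nn_integral_cmult ennreal_mult_less_top)
    show "AE \<theta> in lborel. (\<lambda>N. ennreal ((cmod (S N \<theta>))\<^sup>2) * indicator {0..2*pi} \<theta>)
      \<longlonglongrightarrow> ennreal ((cmod (h (of_real \<rho> * cis \<theta>)))\<^sup>2) * indicator {0..2*pi} \<theta>"
    proof (intro AE_I2)
      fix \<theta>
      have "(\<lambda>N. ennreal ((cmod (S N \<theta>))\<^sup>2)) \<longlonglongrightarrow> ennreal ((cmod (h (of_real \<rho> * cis \<theta>)))\<^sup>2)"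
        by (intro tendsto_intros S_lim)
      then show "(\<lambda>N. ennreal ((cmod (S N \<theta>))\<^sup>2) * indicator {0..2*pi} \<theta>)
      \<longlonglongrightarrow> ennreal ((cmod (h (of_real \<rho> * cis \<theta>)))\<^sup>2) * indicator {0..2*pi} \<theta>"
        by (cases "\<theta> \<in> {0..2*pi}") auto
    qed
  qed auto
  have int_S: "(\<integral>\<^sup>+\<theta>\<in>{0..2*pi}. ennreal ((cmod (S N \<theta>))\<^sup>2) \<partial>lborel)
     = ennreal (2 * pi) * (\<Sum>n<N. ennreal ((cmod (c n))\<^sup>2 * \<rho> ^ (2 * n)))" for N
    using nn_integral_has_integral_lebesgue'[OF _ parseval_polynomial[of c \<rho> N]] \<rho>
    by (simp add: S_def ennreal_mult' sum_nonneg flip: sum_ennreal)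
  have "(\<lambda>N. ennreal (2 * pi) * (\<Sum>n<N. ennreal ((cmod (c n))\<^sup>2 * \<rho> ^ (2 * n))))
     \<longlonglongrightarrow> ennreal (2 * pi) * (\<Sum>n. ennreal ((cmod (c n))\<^sup>2 * \<rho> ^ (2 * n)))"
    by (intro ennreal_tendsto_cmult summable_LIMSEQ) auto
  with lim_int show ?thesis
    unfolding int_S by (rule LIMSEQ_unique)
qed

text \<open>The points where an analytic function attains its maximum on the circles of radius \<open>x\<close> may wander
around the disc, so integrating the squared maximum over \<open>x\<close> is not an integral along one ray. The
series of absolute values of the coefficients dominates the maximum on every circle at once, and
Hilbert's inequality controls the integral of its square along the radius.\<close>

lemma hilbert_inequality_series:
  fixes a :: "nat \<Rightarrow> real"
  assumes a: "\<And>x. \<lbrakk>0 < x; x < 1\<rbrakk> \<Longrightarrow> summable (\<lambda>n. a n * x ^ n)"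
  shows "(\<integral>\<^sup>+x\<in>{0<..<1}. ennreal ((\<Sum>n. a n * x ^ n)\<^sup>2) \<partial>lborel) \<le> ennreal pi * (\<Sum>n. ennreal ((a n)\<^sup>2))"
proof -
  define S where "S N x = (\<Sum>n<N. a n * x ^ n)" for N and x :: real
  have S_meas [measurable]: "S N \<in> borel_measurable borel" for N
    unfolding S_def by (intro borel_measurable_continuous_onI continuous_intros)
  have "(\<integral>\<^sup>+x\<in>{0<..<1}. ennreal ((\<Sum>n. a n * x ^ n)\<^sup>2) \<partial>lborel)
     = (\<integral>\<^sup>+x. liminf (\<lambda>N. ennreal ((S N x)\<^sup>2) * indicator {0<..<1} x) \<partial>lborel)"
  proof (intro nn_integral_cong)
    fix x :: real
    have "(\<lambda>N. ennreal ((S N x)\<^sup>2) * indicator {0<..<1} x) \<longlonglongrightarrow> ennreal ((\<Sum>n. a n * x ^ n)\<^sup>2) * indicator {0<..<1} x"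
    proof (cases "x \<in> {0<..<1}")
      case True
      then have "(\<lambda>N. ennreal ((S N x)\<^sup>2)) \<longlonglongrightarrow> ennreal ((\<Sum>n. a n * x ^ n)\<^sup>2)"
        unfolding S_def by (intro tendsto_intros tendsto_ennrealI summable_LIMSEQ a) auto
      then show ?thesis using True by simp
    qed auto
    then show "ennreal ((\<Sum>n. a n * x ^ n)\<^sup>2) * indicator {0<..<1} x
       = liminf (\<lambda>N. ennreal ((S N x)\<^sup>2) * indicator {0<..<1} x)"
      by (simp add: lim_imp_Liminf)
  qed
  also have "\<dots> \<le> liminf (\<lambda>N. \<integral>\<^sup>+x. ennreal ((S N x)\<^sup>2) * indicator {0<..<1} x \<partial>lborel)"
    by (rule nn_integral_liminf) measurable
  also have "\<dots> \<le> limsup (\<lambda>N. \<integral>\<^sup>+x. ennreal ((S N x)\<^sup>2) * indicator {0<..<1} x \<partial>lborel)"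
    by (rule Liminf_le_Limsup) simp
  also have "\<dots> \<le> ennreal pi * (\<Sum>n. ennreal ((a n)\<^sup>2))"
  proof (rule Limsup_bounded, intro always_eventually allI)
    fix N
    have "(\<integral>\<^sup>+x. ennreal ((S N x)\<^sup>2) * indicator {0<..<1} x \<partial>lborel)
       \<le> (\<integral>\<^sup>+x. ennreal ((S N x)\<^sup>2) * indicator {0..1} x \<partial>lborel)"
      by (intro nn_integral_mono mult_left_mono) (auto simp: indicator_def)
    also have "\<dots> = ennreal (\<Sum>i<N. \<Sum>j<N. a i * a j / (i + j + 1))"
      unfolding S_def
      by (rule nn_integral_has_integral_lebesgue'[OF _ hilbert_inequality_polynomial(1)]) simp
    also have "\<dots> \<le> ennreal (pi * (\<Sum>n<N. (a n)\<^sup>2))"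
      by (rule ennreal_leI[OF hilbert_inequality_polynomial(2)])
    also have "\<dots> = ennreal pi * (\<Sum>n<N. ennreal ((a n)\<^sup>2))"
      by (simp add: ennreal_mult' sum_nonneg flip: sum_ennreal)
    also have "\<dots> \<le> ennreal pi * (\<Sum>n. ennreal ((a n)\<^sup>2))"
      by (intro mult_left_mono sum_le_suminf) auto
    finally show "(\<integral>\<^sup>+x. ennreal ((S N x)\<^sup>2) * indicator {0<..<1} x \<partial>lborel)
       \<le> ennreal pi * (\<Sum>n. ennreal ((a n)\<^sup>2))" .
  qed
  finally show ?thesis .
qed

section \<open>Area of univalent images in polar coordinates\<close>

text \<open>The Jacobian formula for images concerns maps of \<open>real ^ 2\<close>, while iterated integrals live
on \<open>real \<times> real\<close>; this identification of the two Lebesgue measures links them.\<close>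

lemma lborel_pair_conv_vec2:
  "(lborel :: (real \<times> real) measure) = distr (lborel :: (real^2) measure) borel (\<lambda>v. (v $ 1, v $ 2))"
proof (rule lborel_eqI)
  have [measurable]: "(\<lambda>v::real^2. (v $ 1, v $ 2)) \<in> borel_measurable borel"
    by (intro borel_measurable_continuous_onI continuous_intros)
  fix l u :: "real \<times> real"
  assume lu: "\<And>b. b \<in> Basis \<Longrightarrow> l \<bullet> b \<le> u \<bullet> b"
  have *: "fst l \<le> fst u" "snd l \<le> snd u"
    using lu[of "(1, 0)"] lu[of "(0, 1)"] by (auto simp: Basis_prod_def inner_prod_def)
  let ?a = "\<lambda>p :: real \<times> real. \<chi> i::2. if i = 1 then fst p else snd p"
  have "(\<lambda>v::real^2. (v $ 1, v $ 2)) -` box l u = box (?a l) (?a u)"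
    by (cases l; cases u) (auto simp: mem_box_cart forall_2 mem_box Basis_prod_def)
  then have "emeasure (distr (lborel :: (real^2) measure) borel (\<lambda>v. (v $ 1, v $ 2))) (box l u)
     = emeasure lborel (box (?a l) (?a u))"
    by (simp add: emeasure_distr)
  also have "\<dots> = (\<Prod>b\<in>Basis. (?a u - ?a l) \<bullet> b)"
    by (rule emeasure_lborel_box) (use * in \<open>auto simp: Basis_vec_def inner_axis\<close>)
  also have "(\<Prod>b\<in>Basis. (?a u - ?a l) \<bullet> b) = (\<Prod>b\<in>Basis. (u - l) \<bullet> b)"
    by (cases l; cases u)
       (simp add: Basis_vec_def Basis_prod_def UNIV_2 axis_eq_axis inner_axis inner_prod_def)
  finally show "emeasure (distr (lborel :: (real^2) measure) borel (\<lambda>v. (v $ 1, v $ 2))) (box l u)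
      = (\<Prod>b\<in>Basis. (u - l) \<bullet> b)" .
qed simp

definition vec_of_complex :: "complex \<Rightarrow> real^2"
  where "vec_of_complex z = (\<chi> i. if i = 1 then Re z else Im z)"

lemma vec_of_complex_nth [simp]: "vec_of_complex z $ 1 = Re z" "vec_of_complex z $ 2 = Im z"
  by (simp_all add: vec_of_complex_def)

lemma bounded_linear_vec_of_complex: "bounded_linear vec_of_complex"
  unfolding linear_conv_bounded_linear[symmetric]
  by (rule linearI) (simp_all add: vec_eq_iff forall_2)

lemma inj_vec_of_complex: "inj vec_of_complex"
  by (rule injI) (metis vec_of_complex_nth complex_eqI)

lemma inj_on_polar: "inj_on (\<lambda>(\<rho>, \<theta>). of_real \<rho> * cis \<theta>) ({0<..} \<times> {0..<2*pi})"
proof (rule inj_onI, clarsimp)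
  fix \<rho> \<theta> \<rho>' \<theta>' :: real
  assume *: "0 < \<rho>" "0 \<le> \<theta>" "\<theta> < 2*pi" "0 < \<rho>'" "0 \<le> \<theta>'" "\<theta>' < 2*pi"
    and eq: "of_real \<rho> * cis \<theta> = of_real \<rho>' * cis \<theta>'"
  have "cmod (of_real \<rho> * cis \<theta>) = cmod (of_real \<rho>' * cis \<theta>')" by (simp only: eq)
  with * have \<rho>: "\<rho> = \<rho>'" by (simp add: norm_mult)
  with eq * have "exp (\<i> * of_real \<theta>) = exp (\<i> * of_real \<theta>')" by (simp add: cis_conv_exp)
  then have "\<i> * of_real \<theta> = \<i> * of_real \<theta>'" by (rule exp_complex_eqI[rotated]) (use * in auto)
  with \<rho> show "\<rho> = \<rho>' \<and> \<theta> = \<theta>'" by simp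
qed

text \<open>The origin is excluded because the functions of interest contain real powers of \<open>cmod z\<close> and of
\<open>cmod (f z)\<close> with exponents that may be negative.\<close>

lemma polar_borel_measurable:
  fixes g :: "complex \<Rightarrow> real"
  assumes g: "continuous_on (ball 0 1 - {0}) g" and S: "S \<in> sets borel" "S \<subseteq> {0<..<1} \<times> UNIV"
  shows "(\<lambda>x. indicator S x * g (of_real (fst x) * cis (snd x))) \<in> borel_measurable borel"
proof -
  have "continuous_on S (\<lambda>x. g (of_real (fst x) * cis (snd x)))"
    by (intro continuous_intros continuous_on_compose2[OF g]) (use S in \<open>auto simp: norm_mult\<close>)
  from borel_measurable_continuous_on_indicator[OF _ this] S show ?thesis by simp
qed

text \<open>The Jacobian determinant of \<open>(\<rho>, \<theta>) \<mapsto> f (\<rho> * cis \<theta>)\<close> is \<open>\<bar>f'\<bar>\<^sup>2 * \<rho>\<close>, so for injective \<open>f\<close>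
the integral is the area of the image of \<open>S\<close>. That image lies in the disc of radius \<open>t\<close>; the
square of side \<open>2 * t\<close> around it gives a bound of the right order.\<close>

lemma polar_area_injective:
  fixes f :: "complex \<Rightarrow> complex" and S :: "(real \<times> real) set"
  assumes f: "f holomorphic_on ball 0 1" "inj_on f (ball 0 1)"
    and S [measurable]: "S \<in> sets borel" and S_sub: "S \<subseteq> {0<..<1} \<times> {0..<2*pi}"
    and t: "\<And>\<rho> \<theta>. (\<rho>, \<theta>) \<in> S \<Longrightarrow> cmod (f (of_real \<rho> * cis \<theta>)) \<le> t"
  shows "(\<integral>\<^sup>+x\<in>S. ennreal ((cmod (deriv f (of_real (fst x) * cis (snd x))))\<^sup>2 * fst x) \<partial>lborel) \<le> ennreal (4 * t\<^sup>2)"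
proof (cases "S = {}")
  case False
  then have "t \<ge> 0" using t norm_ge_zero order_trans by (metis ex_in_conv surj_pair)
  define z :: "real^2 \<Rightarrow> complex" where "z v = of_real (v $ 1) * cis (v $ 2)" for v
  define S' where "S' = (\<lambda>v::real^2. (v $ 1, v $ 2)) -` S"
  have pair_meas [measurable]: "(\<lambda>v::real^2. (v $ 1, v $ 2)) \<in> borel_measurable borel"
    by (intro borel_measurable_continuous_onI continuous_intros)
  have S'[measurable]: "S' \<in> sets borel"
    unfolding S'_def using measurable_sets_borel[OF pair_meas S] by simp
  have z_in: "z v \<in> ball 0 1" "v $ 1 > 0" if "v \<in> S'" for v :: "real^2"
    using that S_sub by (auto simp: S'_def z_def norm_mult)
  define F where "F v = vec_of_complex (f (z v))" for v
  define F' where "F' v w = vec_of_complex (deriv f (z v) * (of_real (w $ 1) * cis (v $ 2) + of_real (v $ 1) * (of_real (w $ 2) * (\<i> * cis (v $ 2)))))"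
    for v w :: "real^2"
  have der_z: "(z has_derivative (\<lambda>w. of_real (w $ 1) * cis (v $ 2) + of_real (v $ 1) * (of_real (w $ 2) * (\<i> * cis (v $ 2))))) (at v within S')" for v
    unfolding z_def
    by (auto intro!: derivative_eq_intros bounded_linear_imp_has_derivative bounded_linear_vec_nth simp: scaleR_conv_of_real algebra_simps)
  have der: "(F has_derivative F' v) (at v within S')" if "v \<in> S'" for v
  proof -
    have "(f has_field_derivative deriv f (z v)) (at (z v))"
      by (rule holomorphic_derivI[OF f(1)]) (use z_in that in auto)
    then have "(f has_derivative (*) (deriv f (z v))) (at (z v))"
      by (simp add: has_field_derivative_def)
    from has_derivative_compose[OF der_z this] show ?thesis
      unfolding F_def F'_def
      by (rule bounded_linear.has_derivative[OF bounded_linear_vec_of_complex])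
  qed
  have det: "det (matrix (F' v)) = (cmod (deriv f (z v)))\<^sup>2 * v $ 1" for v
  proof -
    have "det (matrix (F' v)) = (cmod (deriv f (z v)))\<^sup>2 * v $ 1 * ((cos (v $ 2))\<^sup>2 + (sin (v $ 2))\<^sup>2)"
      unfolding cmod_power2
      by (simp add: det_2 matrix_def F'_def axis_def power2_eq_square algebra_simps
               del: sin_cos_squared_add sin_cos_squared_add2 sin_cos_squared_add3)
    then show ?thesis by simp
  qed
  have inj: "inj_on F S'"
  proof (rule inj_onI)
    fix v w assume vw: "v \<in> S'" "w \<in> S'" "F v = F w"
    then have "z v = z w"
      using inj_onD[OF f(2)] z_in inj_vec_of_complex by (auto simp: F_def inj_eq)
    then have "(v $ 1, v $ 2) = (w $ 1, w $ 2)"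
      using inj_onD[OF inj_on_polar, of "(v $ 1, v $ 2)" "(w $ 1, w $ 2)"] vw
        subsetD[OF S_sub, of "(v $ 1, v $ 2)"] subsetD[OF S_sub, of "(w $ 1, w $ 2)"]
      by (auto simp: z_def S'_def)
    then show "v = w" by (simp add: vec_eq_iff forall_2)
  qed
  have S'_leb: "S' \<in> sets lebesgue" by simp
  let ?c = "vec_of_complex (Complex t t)"
  have sub: "F ` S' \<subseteq> cbox (- ?c) ?c"
  proof (clarify)
    fix v assume "v \<in> S'"
    then have "cmod (f (z v)) \<le> t" using t by (auto simp: S'_def z_def)
    then have "\<bar>Re (f (z v))\<bar> \<le> t" "\<bar>Im (f (z v))\<bar> \<le> t"
      using abs_Re_le_cmod abs_Im_le_cmod order_trans by blast+
    then show "F v \<in> cbox (- ?c) ?c"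
      by (auto simp: mem_box_cart forall_2 F_def)
  qed
  have "F ` S' \<in> lmeasurable"
  proof (rule bounded_set_imp_lmeasurable)
    show "bounded (F ` S')" using sub bounded_cbox bounded_subset by blast
    show "F ` S' \<in> sets lebesgue"
      by (rule differentiable_image_in_sets_lebesgue[OF S'_leb])
         (use der in \<open>auto simp: differentiable_on_def differentiable_def\<close>)
  qed
  then have int: "(\<lambda>v. \<bar>det (matrix (F' v))\<bar>) integrable_on S'"
    using measurable_differentiable_image_eq[OF S'_leb der inj] by blast
  have "integral S' (\<lambda>v. \<bar>det (matrix (F' v))\<bar>) = measure lebesgue (F ` S')"
    by (rule measure_differentiable_image_eq[OF S'_leb der inj int, symmetric])
  also have "\<dots> \<le> measure lebesgue (cbox (- ?c) ?c)"
    by (rule measure_mono_fmeasurable[OF sub]) (use \<open>F ` S' \<in> lmeasurable\<close> in auto)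
  also have "\<dots> = 4 * t\<^sup>2"
  proof -
    have "cbox (- ?c) ?c \<noteq> {}" using \<open>t \<ge> 0\<close> by (simp add: interval_ne_empty_cart forall_2)
    then show ?thesis
      by (simp add: content_cbox_cart UNIV_2 power2_eq_square)
  qed
  finally have le: "integral S' (\<lambda>v. \<bar>det (matrix (F' v))\<bar>) \<le> 4 * t\<^sup>2" .
  have der_holo: "deriv f holomorphic_on ball 0 1" by (rule holomorphic_deriv[OF f(1)]) auto
  have meas: "(\<lambda>x. ennreal ((cmod (deriv f (of_real (fst x) * cis (snd x))))\<^sup>2 * fst x) * indicator S x) \<in> borel_measurable borel"
  proof -
    have "(\<lambda>x. indicator S x * ((cmod (deriv f (of_real (fst x) * cis (snd x))))\<^sup>2 *
        cmod (of_real (fst x) * cis (snd x)))) \<in> borel_measurable borel"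
      by (rule polar_borel_measurable)
         (use S_sub in \<open>auto intro!: continuous_intros continuous_on_subset[OF holomorphic_on_imp_continuous_on[OF der_holo]]\<close>)
    then have "(\<lambda>x. ennreal (indicator S x * ((cmod (deriv f (of_real (fst x) * cis (snd x))))\<^sup>2 *
        cmod (of_real (fst x) * cis (snd x))))) \<in> borel_measurable borel"
      by measurable
    also have "(\<lambda>x. ennreal (indicator S x * ((cmod (deriv f (of_real (fst x) * cis (snd x))))\<^sup>2 *
        cmod (of_real (fst x) * cis (snd x)))))
       = (\<lambda>x. ennreal ((cmod (deriv f (of_real (fst x) * cis (snd x))))\<^sup>2 * fst x) * indicator S x)"
      using S_sub by (auto simp: fun_eq_iff indicator_def norm_mult)
    finally show ?thesis .
  qed
  have "(\<integral>\<^sup>+x\<in>S. ennreal ((cmod (deriv f (of_real (fst x) * cis (snd x))))\<^sup>2 * fst x) \<partial>lborel)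
     = (\<integral>\<^sup>+v. ennreal ((cmod (deriv f (z v)))\<^sup>2 * v $ 1) * indicator S (v $ 1, v $ 2) \<partial>lborel)"
    unfolding lborel_pair_conv_vec2 by (subst nn_integral_distr) (use meas in \<open>auto simp: z_def\<close>)
  also have "\<dots> = (\<integral>\<^sup>+v. ennreal \<bar>det (matrix (F' v))\<bar> * indicator S' v \<partial>lborel)"
    by (intro nn_integral_cong) (auto simp: det S'_def indicator_def dest: z_in(2)[unfolded S'_def, simplified])
  also have "\<dots> = ennreal (integral S' (\<lambda>v. \<bar>det (matrix (F' v))\<bar>))"
    by (rule nn_integral_has_integral_lebesgue'[OF _ integrable_integral[OF int]]) simp
  also have "\<dots> \<le> ennreal (4 * t\<^sup>2)" by (rule ennreal_leI[OF le])
  finally show ?thesis .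
qed simp


lemma powr_le_on_dyadic_block:
  fixes a u s :: real
  assumes "u / 2 < a" "a \<le> u"
  shows "a powr s \<le> 2 powr \<bar>s\<bar> * u powr s"
proof (cases "s \<ge> 0")
  case True
  have "a powr s \<le> u powr s" using assms True by (intro powr_mono2) auto
  also have "\<dots> \<le> 2 powr \<bar>s\<bar> * u powr s"
    using ge_one_powr_ge_zero[of 2 "\<bar>s\<bar>"] by (intro mult_le_cancel_right1[THEN iffD2]) (auto simp: not_less)
  finally show ?thesis .
next
  case False
  have "a powr s \<le> (u / 2) powr s" using assms False by (intro powr_mono2') auto
  also have "\<dots> = 2 powr \<bar>s\<bar> * u powr s"
    using assms False by (simp add: powr_divide powr_minus_divide)
  finally show ?thesis .
qed

text \<open>For injective \<open>f\<close> the left-hand side is the integral of \<open>\<bar>w\<bar> powr (p - 2)\<close> over the image of a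
disc, a subset of the disc of radius \<open>M\<close>, hence at most a constant multiple of \<open>M powr p\<close>. The
weight is singular at the origin when \<open>p < 2\<close>, so the image is cut into the dyadic annuli
\<open>M / 2 ^ (j + 1) < \<bar>w\<bar> \<le> M / 2 ^ j\<close>: on each the weight is constant up to a factor, the area bound
applies, and the resulting bounds form a geometric series.\<close>

lemma polar_weighted_area_injective:
  fixes f :: "complex \<Rightarrow> complex" and p r M :: real
  assumes f: "f holomorphic_on ball 0 1" "inj_on f (ball 0 1)" "f 0 = 0"
    and p: "p > 0" and r: "0 < r" "r < 1" and M: "\<And>z. cmod z < r \<Longrightarrow> cmod (f z) \<le> M"
  shows "(\<integral>\<^sup>+x\<in>{0<..<r} \<times> {0..<2*pi}. ennreal (cmod (f (of_real (fst x) * cis (snd x))) powr (p - 2) *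
        (cmod (deriv f (of_real (fst x) * cis (snd x))))\<^sup>2 * fst x) \<partial>lborel)
     \<le> ennreal (4 * 2 powr \<bar>p - 2\<bar> / (1 - 2 powr - p) * M powr p)"
proof -
  define S :: "(real \<times> real) set" where "S = {0<..<r} \<times> {0..<2*pi}"
  define z where "z x = of_real (fst x) * cis (snd x)" for x :: "real \<times> real"
  define W where "W x = (cmod (deriv f (z x)))\<^sup>2 * fst x" for x
  define u where "u j = M / 2 ^ j" for j :: nat
  define E where "E j = S \<inter> {x. u j / 2 < cmod (f (z x)) \<and> cmod (f (z x)) \<le> u j}" for j
  define K where "K = (2::real) powr \<bar>p - 2\<bar>"
  have [measurable]: "S \<in> sets borel" by (simp add: S_def borel_Times)
  have S_sub: "S \<subseteq> {0<..<1} \<times> {0..<2*pi}" using r by (auto simp: S_def)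
  have z_in: "z x \<in> ball 0 1 - {0}" "cmod (z x) = fst x" "cmod (z x) < r" if "x \<in> S" for x
    using that r by (auto simp: S_def z_def norm_mult)
  have f_nz: "f w \<noteq> 0" if "w \<in> ball 0 1 - {0}" for w
    using inj_onD[OF f(2), of w 0] f(3) that by auto
  have f_cont: "continuous_on (ball 0 1 - {0}) f"
    by (rule continuous_on_subset[OF holomorphic_on_imp_continuous_on[OF f(1)]]) auto
  have df_cont: "continuous_on (ball 0 1 - {0}) (deriv f)"
    by (rule continuous_on_subset[OF holomorphic_on_imp_continuous_on[OF holomorphic_deriv[OF f(1)]]]) auto
  have M0: "M > 0"
    using M[of "of_real (r/2)"] f_nz[of "of_real (r/2)"] r
    by (smt (verit) DiffI centre_in_ball mem_ball_0 norm_of_real of_real_eq_0_iff singletonD zero_less_norm_iff field_sum_of_halves)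
  have q_meas: "(\<lambda>x. indicator S x * cmod (f (z x))) \<in> borel_measurable borel"
    unfolding z_def by (rule polar_borel_measurable) (use S_sub in \<open>auto intro!: continuous_intros f_cont\<close>)
  have E_meas [measurable]: "E j \<in> sets borel" for j
  proof -
    have "E j = S \<inter> (\<lambda>x. indicator S x * cmod (f (z x))) -` {u j / 2<..u j}"
      by (auto simp: E_def)
    then show ?thesis using measurable_sets_borel[OF q_meas, of "{u j / 2<..u j}"] by simp
  qed
  have W_meas: "(\<lambda>x. ennreal (W x) * indicator T x) \<in> borel_measurable borel" if T: "T \<in> sets borel" "T \<subseteq> S" for T
  proof -
    have "(\<lambda>x. indicator T x * ((cmod (deriv f (z x)))\<^sup>2 * cmod (z x))) \<in> borel_measurable borel"
      unfolding z_def
      by (rule polar_borel_measurable) (use S_sub T in \<open>auto intro!: continuous_intros df_cont\<close>)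
    then have "(\<lambda>x. ennreal (indicator T x * ((cmod (deriv f (z x)))\<^sup>2 * cmod (z x)))) \<in> borel_measurable borel"
      by measurable
    also have "(\<lambda>x. ennreal (indicator T x * ((cmod (deriv f (z x)))\<^sup>2 * cmod (z x)))) = (\<lambda>x. ennreal (W x) * indicator T x)"
      using T z_in by (auto simp: fun_eq_iff indicator_def W_def)
    finally show ?thesis .
  qed
  have W_nonneg: "W x \<ge> 0" if "x \<in> S" for x using that by (auto simp: W_def S_def)
  have block: "\<exists>j. x \<in> E j" if "x \<in> S" for x
  proof -
    let ?a = "cmod (f (z x))"
    have a: "0 < ?a" "?a \<le> M" using f_nz z_in M that by auto
    obtain n0 where "(1/2) ^ n0 < ?a / M"
      using real_arch_pow_inv[of "?a / M" "1/2"] a M0 by auto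
    then have n0: "u n0 < ?a" using M0 by (simp add: u_def field_simps power_divide)
    \<comment> \<open>The predecessor of the first index with threshold below \<open>?a\<close> names the annulus of \<open>f (z x)\<close>.\<close>
    define n where "n = (LEAST n. u n < ?a)"
    have n: "u n < ?a" unfolding n_def using n0 by (rule LeastI)
    have "n \<noteq> 0" using n a by (auto simp: u_def intro!: gr0I)
    then obtain j where j: "n = Suc j" using not0_implies_Suc by blast
    have "\<not> u j < ?a" using not_less_Least[of j "\<lambda>n. u n < ?a"] j n_def by simp
    then show ?thesis using n j that by (auto simp: E_def u_def intro!: exI[of _ j])
  qed
  have "(\<integral>\<^sup>+x\<in>S. ennreal (cmod (f (z x)) powr (p - 2) * (cmod (deriv f (z x)))\<^sup>2 * fst x) \<partial>lborel)
     \<le> (\<integral>\<^sup>+x. (\<Sum>j. ennreal (K * u j powr (p - 2)) * (ennreal (W x) * indicator (E j) x)) \<partial>lborel)"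
  proof (rule nn_integral_mono)
    fix x
    show "ennreal (cmod (f (z x)) powr (p - 2) * (cmod (deriv f (z x)))\<^sup>2 * fst x) * indicator S x
      \<le> (\<Sum>j. ennreal (K * u j powr (p - 2)) * (ennreal (W x) * indicator (E j) x))"
    proof (cases "x \<in> S")
      case True
      then obtain j where j: "x \<in> E j" using block by blast
      have "cmod (f (z x)) powr (p - 2) * W x \<le> K * u j powr (p - 2) * W x"
        unfolding K_def using j by (intro mult_right_mono powr_le_on_dyadic_block W_nonneg True) (auto simp: E_def)
      then have "ennreal (cmod (f (z x)) powr (p - 2) * (cmod (deriv f (z x)))\<^sup>2 * fst x) * indicator S x
         \<le> ennreal (K * u j powr (p - 2) * W x)"
        using True by (auto simp: W_def mult.assoc intro!: ennreal_leI)
      also have "\<dots> = ennreal (K * u j powr (p - 2)) * (ennreal (W x) * indicator (E j) x)"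
        using j W_nonneg[OF True] by (simp add: ennreal_mult' ennreal_mult'' K_def)
      also have "\<dots> \<le> (\<Sum>j. ennreal (K * u j powr (p - 2)) * (ennreal (W x) * indicator (E j) x))"
        using sum_le_suminf[of "\<lambda>j. ennreal (K * u j powr (p - 2)) * (ennreal (W x) * indicator (E j) x)" "{j}"] by simp
      finally show ?thesis .
    qed simp
  qed
  also have "\<dots> = (\<Sum>j. ennreal (K * u j powr (p - 2)) * (\<integral>\<^sup>+x\<in>E j. ennreal (W x) \<partial>lborel))"
    using W_meas[OF E_meas] by (subst nn_integral_suminf) (auto simp: nn_integral_cmult E_def)
  also have "\<dots> \<le> (\<Sum>j. ennreal (4 * K * M powr p * (2 powr - p) ^ j))"
  proof (intro suminf_le summableI)
    fix j
    have "(\<integral>\<^sup>+x\<in>E j. ennreal (W x) \<partial>lborel) \<le> ennreal (4 * (u j)\<^sup>2)"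
      unfolding W_def z_def
      by (rule polar_area_injective[OF f(1,2) E_meas]) (use S_sub in \<open>auto simp: E_def z_def\<close>)
    then have "ennreal (K * u j powr (p - 2)) * (\<integral>\<^sup>+x\<in>E j. ennreal (W x) \<partial>lborel)
       \<le> ennreal (K * u j powr (p - 2)) * ennreal (4 * (u j)\<^sup>2)"
      by (rule mult_left_mono) simp
    also have "\<dots> = ennreal (K * u j powr (p - 2) * (4 * (u j)\<^sup>2))"
      by (simp add: ennreal_mult'')
    also have "K * u j powr (p - 2) * (4 * (u j)\<^sup>2) = 4 * K * u j powr p"
    proof -
      have "u j > 0" using M0 by (simp add: u_def)
      then have "u j powr p = u j powr (p - 2) * (u j)\<^sup>2"
        using powr_add[of "u j" "p - 2" 2] by (simp add: powr_numeral)
      then show ?thesis by simp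
    qed
    also have "u j powr p = M powr p * (2 powr - p) ^ j"
      using M0 by (simp add: u_def powr_divide powr_minus_divide power_divide powr_power flip: powr_realpow powr_powr)
         (simp add: powr_powr mult.commute)
    finally show "ennreal (K * u j powr (p - 2)) * (\<integral>\<^sup>+x\<in>E j. ennreal (W x) \<partial>lborel)
       \<le> ennreal (4 * K * M powr p * (2 powr - p) ^ j)" by (simp add: mult.assoc)
  qed
  also have "\<dots> = ennreal (4 * K * M powr p * (1 / (1 - 2 powr - p)))"
    using p by (intro suminf_ennreal_eq sums_mult geometric_sums) (auto simp: K_def powr_less_one)
  finally show ?thesis by (simp add: S_def z_def K_def mult_ac)
qed

section \<open>Powers of univalent functions and their power series\<close>

text \<open>As \<open>f\<close> is injective with \<open>f 0 = 0\<close>, the quotient \<open>f z / z\<close> has no zero in the disc, so it has a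
holomorphic logarithm \<open>L\<close>. The function \<open>h = exp (p / 2 * L)\<close> is the power \<open>(f z / z) powr (p / 2)\<close>:
it is single-valued even though \<open>f powr (p / 2)\<close> itself branches at the origin. Its square
linearises \<open>\<bar>f\<bar> powr p\<close>, and the last identity is the derivative of
\<open>f powr (p / 2) = z powr (p / 2) * h\<close>, in terms of absolute values.\<close>

lemma univalent_power_root:
  fixes f :: "complex \<Rightarrow> complex" and p :: real
  assumes f: "f holomorphic_on ball 0 1" "inj_on f (ball 0 1)" "f 0 = 0" and p: "p > 0"
  obtains h where "h holomorphic_on ball 0 1"
    and "\<And>z. cmod z < 1 \<Longrightarrow> cmod (f z) powr p = cmod z powr p * (cmod (h z))\<^sup>2"
    and "\<And>z. \<lbrakk>cmod z < 1; z \<noteq> 0\<rbrakk> \<Longrightarrow> cmod (f z) powr (p - 2) * (cmod (deriv f z))\<^sup>2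
           = cmod z powr (p - 2) * (cmod (h z + of_real (2 / p) * (z * deriv h z)))\<^sup>2"
proof -
  obtain g where g: "g holomorphic_on ball 0 1" "\<And>z. cmod z < 1 \<Longrightarrow> f z = z * g z" "deriv f 0 = g 0"
    using Schwarz3[OF f(1,3)] by metis
  have "g z \<noteq> 0" if "z \<in> ball 0 1" for z
  proof (cases "z = 0")
    case True
    have "deriv f 0 \<noteq> 0" by (rule holomorphic_injective_imp_regular[OF f(1) _ f(2)]) auto
    with g(3) True show ?thesis by simp
  next
    case False
    then show ?thesis using inj_onD[OF f(2), of z 0] f(3) g(2)[of z] that by auto
  qed
  then obtain L where L: "L holomorphic_on ball 0 1" "\<And>z. z \<in> ball 0 1 \<Longrightarrow> exp (L z) = g z"
    using holomorphic_logarithm_exists[of "ball 0 1" g 0] g(1) by auto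
  define h where "h z = exp (of_real (p / 2) * L z)" for z
  have f_eq: "f z = z * exp (L z)" if "cmod z < 1" for z
    using g(2) L(2) that by simp
  have L_der: "(L has_field_derivative deriv L z) (at z)" if "cmod z < 1" for z
    by (rule holomorphic_derivI[OF L(1)]) (use that in auto)
  have h_der: "deriv h z = of_real (p / 2) * deriv L z * h z" if "cmod z < 1" for z
    unfolding h_def by (rule DERIV_imp_deriv) (auto intro!: derivative_eq_intros L_der that)
  have f_der: "deriv f z = exp (L z) * (1 + z * deriv L z)" if "cmod z < 1" for z
  proof (rule DERIV_imp_deriv)
    have "((\<lambda>z. z * exp (L z)) has_field_derivative exp (L z) * (1 + z * deriv L z)) (at z)"
      by (auto intro!: derivative_eq_intros L_der that simp: algebra_simps)
    then show "(f has_field_derivative exp (L z) * (1 + z * deriv L z)) (at z)"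
      by (rule has_field_derivative_transform_within_open[where S="ball 0 1"]) (use that f_eq in auto)
  qed
  have h_sq: "(cmod (h z))\<^sup>2 = exp (p * Re (L z))" for z
    by (simp add: h_def power2_eq_square flip: exp_add)
  show ?thesis
  proof (rule that)
    show "h holomorphic_on ball 0 1" unfolding h_def by (intro holomorphic_intros L)
    show "cmod (f z) powr p = cmod z powr p * (cmod (h z))\<^sup>2" if "cmod z < 1" for z
      using that by (simp add: f_eq h_sq norm_mult powr_mult exp_powr_real mult.commute)
    show "cmod (f z) powr (p - 2) * (cmod (deriv f z))\<^sup>2
           = cmod z powr (p - 2) * (cmod (h z + of_real (2 / p) * (z * deriv h z)))\<^sup>2" if "cmod z < 1" "z \<noteq> 0" for z
    proof -
      have "h z + of_real (2 / p) * (z * deriv h z) = h z * (1 + z * deriv L z)"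
        using p that by (simp add: h_der field_simps)
      moreover have "exp (Re (L z)) powr (p - 2) * (exp (Re (L z)))\<^sup>2 = exp (p * Re (L z))"
        by (simp add: exp_powr_real power2_eq_square algebra_simps flip: exp_add)
      ultimately show ?thesis
        using that by (simp add: f_eq f_der h_sq norm_mult powr_mult power_mult_distrib mult_ac)

    qed
  qed
qed

lemma power_series_times_deriv:
  fixes h :: "complex \<Rightarrow> complex"
  assumes h: "\<And>z. cmod z < 1 \<Longrightarrow> (\<lambda>n. c n * z ^ n) sums h z" and z: "cmod z < 1"
  shows "(\<lambda>n. of_nat n * c n * z ^ n) sums (z * deriv h z)"
proof -
  have summ: "summable (\<lambda>n. c n * w ^ n)" if "cmod w < 1" for w
    using h[OF that] by (rule sums_summable)
  have "((\<lambda>w. \<Sum>n. c n * w ^ n) has_field_derivative (\<Sum>n. diffs c n * z ^ n)) (at z)"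
    by (rule termdiffs_strong'[OF summ z])
  then have "(h has_field_derivative (\<Sum>n. diffs c n * z ^ n)) (at z)"
    by (rule has_field_derivative_transform_within_open[where S="ball 0 1"])
       (use z h in \<open>auto simp: sums_iff\<close>)
  then have d: "deriv h z = (\<Sum>n. diffs c n * z ^ n)" by (rule DERIV_imp_deriv)
  have "summable (\<lambda>n. diffs c n * z ^ n)"
    by (rule termdiff_converges[OF z summ])
  then have "(\<lambda>n. diffs c n * z ^ n) sums deriv h z" by (simp add: d summable_sums)
  then have "(\<lambda>n. z * (diffs c n * z ^ n)) sums (z * deriv h z)" by (rule sums_mult)
  then have "(\<lambda>n. of_nat (Suc n) * c (Suc n) * z ^ Suc n) sums (z * deriv h z)"
    by (simp add: diffs_def mult_ac)
  then show ?thesis by (subst (asm) sums_Suc_iff) simp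
qed

section \<open>The maximum modulus\<close>

definition max_modulus :: "(complex \<Rightarrow> complex) \<Rightarrow> real \<Rightarrow> real"
  where "max_modulus f r = (SUP z\<in>cball 0 r. cmod (f z))"

lemma max_modulus_attained:
  assumes f: "f holomorphic_on ball 0 1" and r: "0 \<le> r" "r < 1"
  obtains w where "cmod w \<le> r" "cmod (f w) = max_modulus f r" "\<And>z. cmod z \<le> r \<Longrightarrow> cmod (f z) \<le> cmod (f w)"
proof -
  have "continuous_on (cball 0 r) (\<lambda>z. cmod (f z))"
    using r by (intro continuous_intros continuous_on_subset[OF holomorphic_on_imp_continuous_on[OF f]]) auto
  then obtain w where w: "w \<in> cball 0 r" "\<And>z. z \<in> cball 0 r \<Longrightarrow> cmod (f z) \<le> cmod (f w)"
    using continuous_attains_sup[of "cball 0 r" "\<lambda>z. cmod (f z)"] r by auto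
  then have "max_modulus f r = cmod (f w)"
    unfolding max_modulus_def by (intro cSup_eq_maximum) auto
  with w show ?thesis by (intro that[of w]) auto
qed

lemma norm_le_max_modulus:
  assumes "f holomorphic_on ball 0 1" "cmod z \<le> r" "r < 1"
  shows "cmod (f z) \<le> max_modulus f r"
  using max_modulus_attained[OF assms(1) _ assms(3)] assms(2) norm_ge_zero order_trans by metis

lemma max_modulus_mono:
  assumes "f holomorphic_on ball 0 1" "0 \<le> r" "r \<le> s" "s < 1"
  shows "max_modulus f r \<le> max_modulus f s"
  using max_modulus_attained[OF assms(1,2)] norm_le_max_modulus[OF assms(1) _ assms(4)] assms
  by (metis le_less_trans order_trans)

lemma max_modulus_nonneg:
  assumes "f holomorphic_on ball 0 1" "0 \<le> r" "r < 1"
  shows "0 \<le> max_modulus f r"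
  using norm_le_max_modulus[OF assms(1), of 0 r] assms order_trans[OF norm_ge_zero] by auto

text \<open>For radii \<open>r \<ge> 1\<close> the supremum runs over points where nothing is known about \<open>f\<close>; the
indicator removes them.\<close>

lemma borel_measurable_max_modulus:
  assumes "f holomorphic_on ball 0 1"
  shows "(\<lambda>r. indicator {0<..<1} r * max_modulus f r) \<in> borel_measurable borel"
proof -
  have "max_modulus f \<in> borel_measurable (restrict_space borel {0<..<1})"
    by (rule borel_measurable_mono_on_fnc) (auto intro!: mono_onI max_modulus_mono assms)
  then show ?thesis
    by (subst (asm) borel_measurable_restrict_space_iff) auto
qed

section \<open>Hardy spaces and the maximum modulus\<close>

lemma nn_integral_powr:
  fixes s r :: real
  assumes "s > 0" "r \<ge> 0"
  shows "(\<integral>\<^sup>+x\<in>{0<..<r}. ennreal (x powr (s - 1)) \<partial>lborel) = ennreal (r powr s / s)"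
proof -
  have "((\<lambda>x. x powr (s - 1)) has_integral (r powr s / s)) {0..r}"
    using has_integral_powr_from_0[of "s - 1" r] assms by simp
  then have "((\<lambda>x. x powr (s - 1)) has_integral (r powr s / s)) {0<..<r}"
    by (simp add: has_integral_Icc_iff_Ioo)
  then show ?thesis by (intro nn_integral_has_integral_lebesgue') auto
qed

text \<open>With \<open>h\<close> the \<open>p / 2\<close>-th power of \<open>f z / z\<close>, the weighted area of the image of the disc of radius \<open>r\<close>
can be computed in polar coordinates: Parseval's identity on each circle and integration over the
radii turn it into a series in the coefficients of \<open>h\<close>. On the other hand injectivity bounds it by the
maximum modulus. The factor \<open>2 * n + p\<close> appears squared from the derivative and is divided by once
in the radial integration.\<close>

lemma univalent_coefficient_area_bound:
  fixes f :: "complex \<Rightarrow> complex" and c :: "nat \<Rightarrow> complex" and p r :: real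
  assumes f: "f holomorphic_on ball 0 1" "inj_on f (ball 0 1)" "f 0 = 0" and p: "p > 0"
    and h_holo: "h holomorphic_on ball 0 1"
    and h: "\<And>z. cmod z < 1 \<Longrightarrow> (\<lambda>n. c n * z ^ n) sums h z"
    and fh: "\<And>z. \<lbrakk>cmod z < 1; z \<noteq> 0\<rbrakk> \<Longrightarrow> cmod (f z) powr (p - 2) * (cmod (deriv f z))\<^sup>2
           = cmod z powr (p - 2) * (cmod (h z + of_real (2 / p) * (z * deriv h z)))\<^sup>2"
    and r: "0 < r" "r < 1"
  shows "ennreal (2 * pi / p\<^sup>2) * (\<Sum>n. ennreal ((2 * real n + p) * (cmod (c n))\<^sup>2 * r powr (2 * real n + p)))
    \<le> ennreal (4 * 2 powr \<bar>p - 2\<bar> / (1 - 2 powr - p) * max_modulus f r powr p)"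
proof -
  \<comment> \<open>The coefficients of \<open>k\<close>, which is \<open>(2 / p) * z powr (1 - p / 2)\<close> times the derivative of \<open>f powr (p / 2)\<close>.\<close>
  define d where "d n = of_real ((2 * real n + p) / p) * c n" for n
  define k where "k z = h z + of_real (2 / p) * (z * deriv h z)" for z
  have k: "(\<lambda>n. d n * z ^ n) sums k z" if "cmod z < 1" for z
  proof -
    have "(\<lambda>n. c n * z ^ n + of_real (2 / p) * (of_nat n * c n * z ^ n)) sums k z"
      unfolding k_def by (intro sums_add sums_mult h power_series_times_deriv that)
    also have "(\<lambda>n. c n * z ^ n + of_real (2 / p) * (of_nat n * c n * z ^ n)) = (\<lambda>n. d n * z ^ n)"
      using p by (auto simp: d_def field_simps)
    finally show ?thesis .
  qed
  define S :: "(real \<times> real) set" where "S = {0<..<r} \<times> {0..<2*pi}"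
  define G where "G x = (cmod (k (of_real (fst x) * cis (snd x))))\<^sup>2" for x :: "real \<times> real"
  have "k holomorphic_on ball 0 1"
    unfolding k_def by (intro holomorphic_intros h_holo holomorphic_deriv[OF h_holo]) auto
  then have cont: "continuous_on (ball 0 1) k" by (rule holomorphic_on_imp_continuous_on)
  have G_meas: "(\<lambda>x. ennreal (fst x powr (p - 1) * G x) * indicator S x) \<in> borel_measurable borel"
  proof -
    have "(\<lambda>x. indicator S x * (cmod (of_real (fst x) * cis (snd x)) powr (p - 1) * (cmod (k (of_real (fst x) * cis (snd x))))\<^sup>2)) \<in> borel_measurable borel"
      by (rule polar_borel_measurable)
         (use r in \<open>auto simp: S_def borel_Times intro!: continuous_intros continuous_on_subset[OF cont]\<close>)
    then have "(\<lambda>x. ennreal (indicator S x * (cmod (of_real (fst x) * cis (snd x)) powr (p - 1) * (cmod (k (of_real (fst x) * cis (snd x))))\<^sup>2))) \<in> borel_measurable borel"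
      by measurable
    also have "(\<lambda>x. ennreal (indicator S x * (cmod (of_real (fst x) * cis (snd x)) powr (p - 1) * (cmod (k (of_real (fst x) * cis (snd x))))\<^sup>2)))
       = (\<lambda>x. ennreal (fst x powr (p - 1) * G x) * indicator S x)"
      by (auto simp: fun_eq_iff indicator_def norm_mult S_def G_def)
    finally show ?thesis .
  qed
  have "(\<integral>\<^sup>+x\<in>S. ennreal (fst x powr (p - 1) * G x) \<partial>lborel)
     = (\<integral>\<^sup>+x\<in>S. ennreal (cmod (f (of_real (fst x) * cis (snd x))) powr (p - 2) *
        (cmod (deriv f (of_real (fst x) * cis (snd x))))\<^sup>2 * fst x) \<partial>lborel)"
  proof (intro nn_integral_cong)
    fix x :: "real \<times> real"
    show "ennreal (fst x powr (p - 1) * G x) * indicator S x =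
       ennreal (cmod (f (of_real (fst x) * cis (snd x))) powr (p - 2) *
        (cmod (deriv f (of_real (fst x) * cis (snd x))))\<^sup>2 * fst x) * indicator S x"
    proof (cases "x \<in> S")
      case True
      then have x: "0 < fst x" "fst x < 1" using r by (auto simp: S_def)
      have "fst x powr (p - 1) = fst x powr (p - 2) * fst x"
        using x powr_add[of "fst x" "p - 2" 1] by simp
      then have "fst x powr (p - 1) * G x = cmod (f (of_real (fst x) * cis (snd x))) powr (p - 2) *
        (cmod (deriv f (of_real (fst x) * cis (snd x))))\<^sup>2 * fst x"
        using fh[of "of_real (fst x) * cis (snd x)"] x by (simp add: norm_mult G_def k_def)
      then show ?thesis by simp
    qed simp
  qed
  also have "\<dots> \<le> ennreal (4 * 2 powr \<bar>p - 2\<bar> / (1 - 2 powr - p) * max_modulus f r powr p)"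
    unfolding S_def
    by (rule polar_weighted_area_injective[OF f p r]) (use r in \<open>auto intro!: norm_le_max_modulus[OF f(1)]\<close>)
  finally have le: "(\<integral>\<^sup>+x\<in>S. ennreal (fst x powr (p - 1) * G x) \<partial>lborel)
     \<le> ennreal (4 * 2 powr \<bar>p - 2\<bar> / (1 - 2 powr - p) * max_modulus f r powr p)" .
  have "(\<integral>\<^sup>+x\<in>S. ennreal (fst x powr (p - 1) * G x) \<partial>lborel)
     = (\<integral>\<^sup>+\<rho>. \<integral>\<^sup>+\<theta>. ennreal (\<rho> powr (p - 1) * G (\<rho>, \<theta>)) * indicator S (\<rho>, \<theta>) \<partial>lborel \<partial>lborel)"
    unfolding lborel_prod[symmetric]
    using lborel.nn_integral_fst[of "\<lambda>x. ennreal (fst x powr (p - 1) * G x) * indicator S x" lborel] G_meas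
    by (simp add: lborel_prod)
  also have "\<dots> = (\<integral>\<^sup>+\<rho>. (\<Sum>n. ennreal (2 * pi * (cmod (d n))\<^sup>2) * (ennreal (\<rho> powr (2 * real n + p - 1)) * indicator {0<..<r} \<rho>)) \<partial>lborel)"
  proof (intro nn_integral_cong)
    fix \<rho> :: real
    show "(\<integral>\<^sup>+\<theta>. ennreal (\<rho> powr (p - 1) * G (\<rho>, \<theta>)) * indicator S (\<rho>, \<theta>) \<partial>lborel)
      = (\<Sum>n. ennreal (2 * pi * (cmod (d n))\<^sup>2) * (ennreal (\<rho> powr (2 * real n + p - 1)) * indicator {0<..<r} \<rho>))"
    proof (cases "\<rho> \<in> {0<..<r}")
      case True
      have [measurable]: "(\<lambda>\<theta>. G (\<rho>, \<theta>)) \<in> borel_measurable borel"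
        unfolding G_def fst_conv snd_conv
        by (intro borel_measurable_continuous_onI continuous_intros continuous_on_compose2[OF cont])
           (use True r in \<open>auto simp: norm_mult\<close>)
      have "(\<integral>\<^sup>+\<theta>. ennreal (\<rho> powr (p - 1) * G (\<rho>, \<theta>)) * indicator S (\<rho>, \<theta>) \<partial>lborel)
        = (\<integral>\<^sup>+\<theta>. ennreal (\<rho> powr (p - 1)) * (ennreal (G (\<rho>, \<theta>)) * indicator {0..2*pi} \<theta>) \<partial>lborel)"
        \<comment> \<open>The half-open angular interval, on which polar coordinates are injective, differs by one point.\<close>
        by (intro nn_integral_cong_AE eventually_mono[OF AE_lborel_singleton[of "2*pi"]])
           (use True in \<open>auto simp: S_def indicator_def ennreal_mult'\<close>)
      also have "\<dots> = ennreal (\<rho> powr (p - 1)) * (\<integral>\<^sup>+\<theta>\<in>{0..2*pi}. ennreal (G (\<rho>, \<theta>)) \<partial>lborel)"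
        by (subst nn_integral_cmult) auto
      also have "(\<integral>\<^sup>+\<theta>\<in>{0..2*pi}. ennreal (G (\<rho>, \<theta>)) \<partial>lborel)
         = ennreal (2*pi) * (\<Sum>n. ennreal ((cmod (d n))\<^sup>2 * \<rho> ^ (2 * n)))"
        unfolding G_def fst_conv snd_conv by (rule parseval_circle[OF k]) (use True r in auto)
      also have "ennreal (\<rho> powr (p - 1)) * (ennreal (2*pi) * (\<Sum>n. ennreal ((cmod (d n))\<^sup>2 * \<rho> ^ (2 * n))))
         = (\<Sum>n. ennreal (\<rho> powr (p - 1)) * (ennreal (2*pi) * ennreal ((cmod (d n))\<^sup>2 * \<rho> ^ (2 * n))))"
        by simp
      also have "\<dots> = (\<Sum>n. ennreal (2 * pi * (cmod (d n))\<^sup>2) * (ennreal (\<rho> powr (2 * real n + p - 1)) * indicator {0<..<r} \<rho>))"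
      proof (rule suminf_cong)
        fix n
        have "\<rho> powr (2 * real n + p - 1) = \<rho> powr (p - 1) * \<rho> ^ (2 * n)"
          using True powr_add[of \<rho> "p - 1" "2 * real n"] powr_realpow[of \<rho> "2 * n"] by (simp add: algebra_simps)
        then show "ennreal (\<rho> powr (p - 1)) * (ennreal (2*pi) * ennreal ((cmod (d n))\<^sup>2 * \<rho> ^ (2 * n)))
          = ennreal (2 * pi * (cmod (d n))\<^sup>2) * (ennreal (\<rho> powr (2 * real n + p - 1)) * indicator {0<..<r} \<rho>)"
          using True by (simp add: mult_ac flip: ennreal_mult')
      qed
      finally show ?thesis .
    qed (auto simp: S_def indicator_def)
  qed
  also have "\<dots> = (\<Sum>n. ennreal (2 * pi * (cmod (d n))\<^sup>2) * (\<integral>\<^sup>+\<rho>\<in>{0<..<r}. ennreal (\<rho> powr (2 * real n + p - 1)) \<partial>lborel))"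
    by (subst nn_integral_suminf) (auto simp: nn_integral_cmult)
  also have "\<dots> = (\<Sum>n. ennreal (2 * pi * (cmod (d n))\<^sup>2) * ennreal (r powr (2 * real n + p) / (2 * real n + p)))"
    using p r by (subst nn_integral_powr) auto
  also have "\<dots> = (\<Sum>n. ennreal (2 * pi / p\<^sup>2) * ennreal ((2 * real n + p) * (cmod (c n))\<^sup>2 * r powr (2 * real n + p)))"
  proof (rule suminf_cong)
    fix n
    have "2 * pi * (cmod (d n))\<^sup>2 * (r powr (2 * real n + p) / (2 * real n + p))
       = 2 * pi / p\<^sup>2 * ((2 * real n + p) * (cmod (c n))\<^sup>2 * r powr (2 * real n + p))"
    proof -
      have "2 * real n + p > 0" using p by (simp add: add_nonneg_pos)
      then have "(cmod (d n))\<^sup>2 = (2 * real n + p)\<^sup>2 / p\<^sup>2 * (cmod (c n))\<^sup>2"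
        using p by (simp add: d_def norm_mult power_mult_distrib power_divide norm_divide del: of_real_add of_real_divide of_real_mult)
      then show ?thesis using \<open>2 * real n + p > 0\<close> by (simp add: power2_eq_square)
    qed
    then show "ennreal (2 * pi * (cmod (d n))\<^sup>2) * ennreal (r powr (2 * real n + p) / (2 * real n + p))
      = ennreal (2 * pi / p\<^sup>2) * ennreal ((2 * real n + p) * (cmod (c n))\<^sup>2 * r powr (2 * real n + p))"
      by (metis ennreal_mult' mult_nonneg_nonneg divide_nonneg_nonneg pi_ge_zero zero_le_numeral zero_le_power2)
  qed
  also have "\<dots> = ennreal (2 * pi / p\<^sup>2) * (\<Sum>n. ennreal ((2 * real n + p) * (cmod (c n))\<^sup>2 * r powr (2 * real n + p)))"
    by simp
  finally show ?thesis using le by simp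
qed


text \<open>Integrating the area bound over \<open>0 < r < 1\<close> cancels the weight \<open>2 * n + p\<close> up to the factor
\<open>(2 * n + p) / (2 * n + p + 1)\<close>, which is at least \<open>p / (p + 1)\<close>. This is the step that converts
injectivity into an estimate of means by the maximum modulus.\<close>

lemma univalent_coefficient_sum_le:
  fixes f :: "complex \<Rightarrow> complex" and c :: "nat \<Rightarrow> complex" and p :: real
  assumes f: "f holomorphic_on ball 0 1" "inj_on f (ball 0 1)" "f 0 = 0" and p: "p > 0"
    and h_holo: "h holomorphic_on ball 0 1"
    and h: "\<And>z. cmod z < 1 \<Longrightarrow> (\<lambda>n. c n * z ^ n) sums h z"
    and fh: "\<And>z. \<lbrakk>cmod z < 1; z \<noteq> 0\<rbrakk> \<Longrightarrow> cmod (f z) powr (p - 2) * (cmod (deriv f z))\<^sup>2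
           = cmod z powr (p - 2) * (cmod (h z + of_real (2 / p) * (z * deriv h z)))\<^sup>2"
    and fin: "(\<integral>\<^sup>+r\<in>{0<..<1}. ennreal (max_modulus f r powr p) \<partial>lborel) < \<infinity>"
  shows "(\<Sum>n. ennreal ((cmod (c n))\<^sup>2)) < \<infinity>"
proof -
  define A where "A = 2 * pi / p\<^sup>2"
  define B where "B = 4 * 2 powr \<bar>p - 2\<bar> / (1 - 2 powr - p)"
  have A: "A > 0" using p by (simp add: A_def)
  have "(2::real) powr - p < 1" using p by (simp add: powr_less_one)
  then have B: "B \<ge> 0" by (simp add: B_def)
  have M_meas [measurable]: "(\<lambda>r. ennreal (max_modulus f r powr p) * indicator {0<..<1} r) \<in> borel_measurable borel"
  proof -
    have "(\<lambda>r. ennreal ((indicator {0<..<1} r * max_modulus f r) powr p)) \<in> borel_measurable borel"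
      using borel_measurable_max_modulus[OF f(1)] by measurable
    also have "(\<lambda>r. ennreal ((indicator {0<..<1} r * max_modulus f r) powr p))
       = (\<lambda>r. ennreal (max_modulus f r powr p) * indicator {0<..<1} r)"
      using p by (auto simp: fun_eq_iff indicator_def)
    finally show ?thesis .
  qed
  have "ennreal (A * (p / (p + 1))) * (\<Sum>n. ennreal ((cmod (c n))\<^sup>2))
     = (\<Sum>n. ennreal (A * (p / (p + 1)) * (cmod (c n))\<^sup>2))"
    using A p by (subst ennreal_suminf_cmult[symmetric]) (simp only: ennreal_mult'[OF zero_le_power2, symmetric] ennreal_mult'' zero_le_power2)
  also have "\<dots> \<le> (\<Sum>n. ennreal (A * ((2 * real n + p) * (cmod (c n))\<^sup>2 / (2 * real n + p + 1))))"
  proof (intro suminf_le summableI ennreal_leI)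
    fix n
    have "p / (p + 1) \<le> (2 * real n + p) / (2 * real n + p + 1)"
      using p by (simp add: divide_simps) (simp add: algebra_simps)
    then have "A * (p / (p + 1) * (cmod (c n))\<^sup>2) \<le> A * ((2 * real n + p) / (2 * real n + p + 1) * (cmod (c n))\<^sup>2)"
      using A by (intro mult_left_mono mult_right_mono) auto
    then show "A * (p / (p + 1)) * (cmod (c n))\<^sup>2 \<le> A * ((2 * real n + p) * (cmod (c n))\<^sup>2 / (2 * real n + p + 1))"
      by (simp add: mult.assoc)
  qed
  also have "\<dots> = (\<Sum>n. ennreal (A * (2 * real n + p) * (cmod (c n))\<^sup>2) * (\<integral>\<^sup>+r\<in>{0<..<1}. ennreal (r powr (2 * real n + p)) \<partial>lborel))"
  proof (rule suminf_cong)
    fix n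
    have "(\<integral>\<^sup>+r\<in>{0<..<1}. ennreal (r powr (2 * real n + p)) \<partial>lborel) = ennreal (1 / (2 * real n + p + 1))"
      using nn_integral_powr[of "2 * real n + p + 1" 1] p by simp
    then show "ennreal (A * ((2 * real n + p) * (cmod (c n))\<^sup>2 / (2 * real n + p + 1))) =
      ennreal (A * (2 * real n + p) * (cmod (c n))\<^sup>2) * (\<integral>\<^sup>+r\<in>{0<..<1}. ennreal (r powr (2 * real n + p)) \<partial>lborel)"
      using A p by (simp add: mult.assoc flip: ennreal_mult')
  qed
  also have "\<dots> = (\<integral>\<^sup>+r. (\<Sum>n. ennreal (A * (2 * real n + p) * (cmod (c n))\<^sup>2) * (ennreal (r powr (2 * real n + p)) * indicator {0<..<1} r)) \<partial>lborel)"
    by (subst nn_integral_suminf) (auto simp: nn_integral_cmult)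
  also have "\<dots> \<le> (\<integral>\<^sup>+r. ennreal B * (ennreal (max_modulus f r powr p) * indicator {0<..<1} r) \<partial>lborel)"
  proof (rule nn_integral_mono)
    fix r :: real
    show "(\<Sum>n. ennreal (A * (2 * real n + p) * (cmod (c n))\<^sup>2) * (ennreal (r powr (2 * real n + p)) * indicator {0<..<1} r))
      \<le> ennreal B * (ennreal (max_modulus f r powr p) * indicator {0<..<1} r)"
    proof (cases "r \<in> {0<..<1}")
      case True
      have "(\<Sum>n. ennreal (A * (2 * real n + p) * (cmod (c n))\<^sup>2) * (ennreal (r powr (2 * real n + p)) * indicator {0<..<1} r))
         = (\<Sum>n. ennreal A * ennreal ((2 * real n + p) * (cmod (c n))\<^sup>2 * r powr (2 * real n + p)))"
        using True A p by (intro suminf_cong) (simp add: mult.assoc flip: ennreal_mult')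
      also have "\<dots> = ennreal A * (\<Sum>n. ennreal ((2 * real n + p) * (cmod (c n))\<^sup>2 * r powr (2 * real n + p)))"
        by simp
      also have "\<dots> \<le> ennreal (B * max_modulus f r powr p)"
        unfolding A_def B_def
        by (rule univalent_coefficient_area_bound[OF f p h_holo h fh]) (use True in auto)
      finally show ?thesis using True B by (simp add: ennreal_mult')
    qed simp
  qed
  also have "\<dots> = ennreal B * (\<integral>\<^sup>+r\<in>{0<..<1}. ennreal (max_modulus f r powr p) \<partial>lborel)"
    by (rule nn_integral_cmult) simp
  also have "\<dots> < \<infinity>" using fin by (simp add: ennreal_mult_less_top)
  finally have "ennreal (A * (p / (p + 1))) * (\<Sum>n. ennreal ((cmod (c n))\<^sup>2)) < \<infinity>" .
  moreover have "ennreal (A * (p / (p + 1))) \<noteq> 0" using A p by (simp add: not_le)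
  ultimately show ?thesis by (auto simp: ennreal_mult_less_top)
qed

text \<open>The circular means of \<open>\<bar>f\<bar> powr p\<close> are \<open>r powr p\<close> times those of \<open>\<bar>h\<bar>\<^sup>2\<close>, hence explicit series
in the coefficients by Parseval, increasing to \<open>2 * pi\<close> times the sum of squares as \<open>r \<longrightarrow> 1\<close>.\<close>

lemma hardy_space_iff_coefficients:
  fixes f h :: "complex \<Rightarrow> complex" and c :: "nat \<Rightarrow> complex" and p :: real
  assumes f: "f holomorphic_on ball 0 1" and p: "p > 0"
    and h: "\<And>z. cmod z < 1 \<Longrightarrow> (\<lambda>n. c n * z ^ n) sums h z"
    and fh: "\<And>z. cmod z < 1 \<Longrightarrow> cmod (f z) powr p = cmod z powr p * (cmod (h z))\<^sup>2"
  shows "f \<in> hardy_space p \<longleftrightarrow> (\<Sum>n. ennreal ((cmod (c n))\<^sup>2)) < \<infinity>"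
proof -
  define I where "I r = (\<integral>\<^sup>+\<theta>\<in>{0..2*pi}. ennreal (cmod (f (of_real r * exp (\<i> * of_real \<theta>))) powr p) \<partial>lborel)" for r
  define \<Sigma> where "\<Sigma> = (\<Sum>n. ennreal ((cmod (c n))\<^sup>2))"
  have I: "I r = ennreal (r powr p) * (ennreal (2 * pi) * (\<Sum>n. ennreal ((cmod (c n))\<^sup>2 * r ^ (2 * n))))"
    if r: "r \<in> {0<..<1}" for r
  proof -
    have [measurable]: "(\<lambda>\<theta>. h (of_real r * cis \<theta>)) \<in> borel_measurable borel"
    proof (rule borel_measurable_LIMSEQ_metric)
      show "(\<lambda>\<theta>. \<Sum>n<N. c n * (of_real r * cis \<theta>) ^ n) \<in> borel_measurable borel" for N
        by (intro borel_measurable_continuous_onI continuous_intros)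
      show "(\<lambda>N. \<Sum>n<N. c n * (of_real r * cis \<theta>) ^ n) \<longlonglongrightarrow> h (of_real r * cis \<theta>)" for \<theta>
        using h[of "of_real r * cis \<theta>"] r by (simp add: sums_def norm_mult)
    qed
    have "I r = (\<integral>\<^sup>+\<theta>. ennreal (r powr p) * (ennreal ((cmod (h (of_real r * cis \<theta>)))\<^sup>2) * indicator {0..2*pi} \<theta>) \<partial>lborel)"
      unfolding I_def using r
      by (intro nn_integral_cong) (simp add: fh norm_mult ennreal_mult' mult.assoc flip: cis_conv_exp)
    also have "\<dots> = ennreal (r powr p) * (\<integral>\<^sup>+\<theta>\<in>{0..2*pi}. ennreal ((cmod (h (of_real r * cis \<theta>)))\<^sup>2) \<partial>lborel)"
      by (rule nn_integral_cmult) simp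
    finally show ?thesis using r by (simp add: parseval_circle[OF h])
  qed
  have "(SUP r\<in>{0<..<1}. I r) = ennreal (2 * pi) * \<Sigma>"
  proof (rule antisym)
    show "(SUP r\<in>{0<..<1}. I r) \<le> ennreal (2 * pi) * \<Sigma>"
    proof (rule SUP_least)
      fix r :: real assume r: "r \<in> {0<..<1}"
      have "r powr p \<le> 1" using r p by (simp add: powr_le1)
      then have "I r \<le> 1 * (ennreal (2 * pi) * (\<Sum>n. ennreal ((cmod (c n))\<^sup>2 * r ^ (2 * n))))"
        unfolding I[OF r] by (intro mult_right_mono) auto
      also have "\<dots> \<le> 1 * (ennreal (2 * pi) * \<Sigma>)"
        unfolding \<Sigma>_def using r
        by (intro mult_left_mono suminf_le summableI ennreal_leI mult_left_le power_le_one) auto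
      finally show "I r \<le> ennreal (2 * pi) * \<Sigma>" by simp
    qed
    show "ennreal (2 * pi) * \<Sigma> \<le> (SUP r\<in>{0<..<1}. I r)"
    proof -
      have "ennreal (2 * pi) * (\<Sum>n<N. ennreal ((cmod (c n))\<^sup>2)) \<le> (SUP r\<in>{0<..<1}. I r)" for N
      proof -
        let ?P = "\<lambda>r. r powr p * (2 * pi * (\<Sum>n<N. (cmod (c n))\<^sup>2 * r ^ (2 * n)))"
        have "((\<lambda>r. ennreal (?P r)) \<longlongrightarrow> ennreal (?P 1)) (at_left 1)"
          by (intro tendsto_intros) auto
        moreover have "eventually (\<lambda>r. ennreal (?P r) \<le> (SUP r\<in>{0<..<1}. I r)) (at_left 1)"
          using eventually_at_left_real[of 0 1, OF zero_less_one]
        proof (rule eventually_mono)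
          fix r :: real assume r: "r \<in> {0<..<1}"
          have "ennreal (?P r) = ennreal (r powr p) * (ennreal (2 * pi) * (\<Sum>n<N. ennreal ((cmod (c n))\<^sup>2 * r ^ (2 * n))))"
            using r by (simp add: ennreal_mult' sum_nonneg flip: sum_ennreal)
          also have "\<dots> \<le> I r"
            unfolding I[OF r] by (intro mult_left_mono sum_le_suminf) auto
          also have "\<dots> \<le> (SUP r\<in>{0<..<1}. I r)" using r by (rule SUP_upper)
          finally show "ennreal (?P r) \<le> (SUP r\<in>{0<..<1}. I r)" .
        qed
        ultimately have "ennreal (?P 1) \<le> (SUP r\<in>{0<..<1}. I r)"
          by (rule tendsto_upperbound) auto
        then show ?thesis by (simp add: ennreal_mult' sum_nonneg flip: sum_ennreal)
      qed
      then show ?thesis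
        unfolding \<Sigma>_def suminf_eq_SUP by (subst SUP_mult_left_ennreal) (auto intro!: SUP_least)
    qed
  qed
  then have "(SUP r\<in>{0<..<1}. I r) < \<infinity> \<longleftrightarrow> \<Sigma> < \<infinity>"
    by (auto simp: ennreal_mult_less_top)
  then show ?thesis
    using f by (simp add: hardy_space_def I_def \<Sigma>_def)
qed

text \<open>The maximum of \<open>\<bar>h\<bar>\<close> on the disc of radius \<open>r\<close> is at most \<open>\<Sum>n. cmod (c n) * r ^ n\<close>, so this
estimate is Hilbert's inequality.\<close>

lemma max_modulus_integral_le_coefficients:
  fixes f h :: "complex \<Rightarrow> complex" and c :: "nat \<Rightarrow> complex" and p :: real
  assumes f: "f holomorphic_on ball 0 1" and p: "p > 0"
    and h: "\<And>z. cmod z < 1 \<Longrightarrow> (\<lambda>n. c n * z ^ n) sums h z"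
    and fh: "\<And>z. cmod z < 1 \<Longrightarrow> cmod (f z) powr p = cmod z powr p * (cmod (h z))\<^sup>2"
  shows "(\<integral>\<^sup>+r\<in>{0<..<1}. ennreal (max_modulus f r powr p) \<partial>lborel) \<le> ennreal pi * (\<Sum>n. ennreal ((cmod (c n))\<^sup>2))"
proof -
  have summ: "summable (\<lambda>n. cmod (c n) * x ^ n)" if x: "0 < x" "x < 1" for x :: real
  proof -
    obtain y where y: "x < y" "y < 1" using dense[OF x(2)] by blast
    have "summable (\<lambda>n. c n * of_real y ^ n)"
      using h[of "of_real y"] x y by (auto simp: sums_iff)
    then have "summable (\<lambda>n. cmod (c n * of_real x ^ n))"
      by (rule powser_insidea) (use x y in auto)
    then show ?thesis using x by (simp add: norm_mult norm_power)
  qed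
  have "(\<integral>\<^sup>+r\<in>{0<..<1}. ennreal (max_modulus f r powr p) \<partial>lborel)
     \<le> (\<integral>\<^sup>+r\<in>{0<..<1}. ennreal ((\<Sum>n. cmod (c n) * r ^ n)\<^sup>2) \<partial>lborel)"
  proof (rule nn_integral_mono)
    fix r :: real
    have "max_modulus f r powr p \<le> (\<Sum>n. cmod (c n) * r ^ n)\<^sup>2" if r: "0 < r" "r < 1"
    proof -
      obtain w where w: "cmod w \<le> r" "cmod (f w) = max_modulus f r"
        using max_modulus_attained[OF f] r by (metis less_imp_le)
      have "cmod (h w) \<le> (\<Sum>n. cmod (c n) * r ^ n)"
      proof -
        have "h w = (\<Sum>n. c n * w ^ n)" using h[of w] w r by (simp add: sums_iff)
        also have "cmod \<dots> \<le> (\<Sum>n. cmod (c n) * r ^ n)"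
          by (rule norm_suminf_le[OF _ summ[OF r]])
             (use w in \<open>auto simp: norm_mult norm_power intro!: mult_left_mono power_mono\<close>)
        finally show ?thesis .
      qed
      moreover have "max_modulus f r powr p \<le> 1 * (cmod (h w))\<^sup>2"
      proof -
        have "cmod w powr p \<le> 1" using w r p by (intro powr_le1) auto
        moreover have "max_modulus f r powr p = cmod w powr p * (cmod (h w))\<^sup>2"
          using fh[of w] w r by simp
        ultimately show ?thesis by (simp only: mult_right_mono zero_le_power2)
      qed
      ultimately show ?thesis by (smt (verit) norm_ge_zero power_mono)
    qed
    then show "ennreal (max_modulus f r powr p) * indicator {0<..<1} r
       \<le> ennreal ((\<Sum>n. cmod (c n) * r ^ n)\<^sup>2) * indicator {0<..<1} r"
      by (auto simp: indicator_def intro!: ennreal_leI)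
  qed
  also have "\<dots> \<le> ennreal pi * (\<Sum>n. ennreal ((cmod (c n))\<^sup>2))"
    by (rule hilbert_inequality_series[OF summ])
  finally show ?thesis .
qed

lemma univalent_hardy_iff_max_modulus_normalised:
  fixes f :: "complex \<Rightarrow> complex" and p :: real
  assumes f: "f holomorphic_on ball 0 1" "inj_on f (ball 0 1)" "f 0 = 0" and p: "p > 0"
  shows "f \<in> hardy_space p \<longleftrightarrow> (\<integral>\<^sup>+r\<in>{0<..<1}. ennreal (max_modulus f r powr p) \<partial>lborel) < \<infinity>"
proof -
  show ?thesis
  proof (rule univalent_power_root[OF f p])
    fix h :: "complex \<Rightarrow> complex"
    assume h: "h holomorphic_on ball 0 1"
      and fh: "\<And>z. cmod z < 1 \<Longrightarrow> cmod (f z) powr p = cmod z powr p * (cmod (h z))\<^sup>2"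
      and dfh: "\<And>z. \<lbrakk>cmod z < 1; z \<noteq> 0\<rbrakk> \<Longrightarrow> cmod (f z) powr (p - 2) * (cmod (deriv f z))\<^sup>2
             = cmod z powr (p - 2) * (cmod (h z + of_real (2 / p) * (z * deriv h z)))\<^sup>2"
    define c where "c n = (deriv ^^ n) h 0 / fact n" for n
    have c: "(\<lambda>n. c n * z ^ n) sums h z" if "cmod z < 1" for z
      using holomorphic_power_series[OF h, of z] that by (simp add: c_def)
    define \<Sigma> where "\<Sigma> = (\<Sum>n. ennreal ((cmod (c n))\<^sup>2))"
    have "f \<in> hardy_space p \<longleftrightarrow> \<Sigma> < \<infinity>"
      unfolding \<Sigma>_def by (rule hardy_space_iff_coefficients[OF f(1) p c fh])
    also have "\<dots> \<longleftrightarrow> (\<integral>\<^sup>+r\<in>{0<..<1}. ennreal (max_modulus f r powr p) \<partial>lborel) < \<infinity>"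
    proof
      assume "\<Sigma> < \<infinity>"
      then have "ennreal pi * \<Sigma> < \<infinity>" by (simp add: ennreal_mult_less_top)
      with max_modulus_integral_le_coefficients[OF f(1) p c fh]
      show "(\<integral>\<^sup>+r\<in>{0<..<1}. ennreal (max_modulus f r powr p) \<partial>lborel) < \<infinity>"
        unfolding \<Sigma>_def by (rule le_less_trans)
    next
      assume "(\<integral>\<^sup>+r\<in>{0<..<1}. ennreal (max_modulus f r powr p) \<partial>lborel) < \<infinity>"
      then show "\<Sigma> < \<infinity>"
        unfolding \<Sigma>_def by - (rule univalent_coefficient_sum_le[OF f p h c dfh])
    qed
    finally show ?thesis .
  qed
qed

lemma powr_add_le:
  fixes a b p :: real
  assumes "a \<ge> 0" "b \<ge> 0" "p > 0"
  shows "(a + b) powr p \<le> 2 powr p * (a powr p + b powr p)"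
proof -
  have "(a + b) powr p \<le> (2 * max a b) powr p" using assms by (intro powr_mono2) auto
  also have "\<dots> = 2 powr p * max a b powr p" by (rule powr_mult)
  also have "max a b powr p \<le> a powr p + b powr p" by (simp add: max_def)
  finally show ?thesis by simp
qed

text \<open>One estimate for two purposes: with \<open>A\<close> a period it shows that Hardy spaces contain the constants,
and with \<open>A\<close> the interval of radii that the integral of the maximum modulus is insensitive to
translations. Both serve to reduce to functions that vanish at the origin.\<close>

lemma nn_integral_powr_le_of_add_const:
  fixes u v :: "real \<Rightarrow> real"
  assumes p: "p > 0" and k: "k \<ge> 0" and A: "A \<in> sets borel"
    and v: "\<And>x. x \<in> A \<Longrightarrow> 0 \<le> v x" "(\<lambda>x. indicator A x * v x) \<in> borel_measurable borel"
    and u: "\<And>x. x \<in> A \<Longrightarrow> 0 \<le> u x" "\<And>x. x \<in> A \<Longrightarrow> u x \<le> v x + k"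
  shows "(\<integral>\<^sup>+x\<in>A. ennreal (u x powr p) \<partial>lborel)
    \<le> ennreal (2 powr p) * ((\<integral>\<^sup>+x\<in>A. ennreal (v x powr p) \<partial>lborel) + ennreal (k powr p) * emeasure lborel A)"
proof -
  have [measurable]: "(\<lambda>x. ennreal (v x powr p) * indicator A x) \<in> borel_measurable borel"
  proof -
    have "(\<lambda>x. ennreal ((indicator A x * v x) powr p)) \<in> borel_measurable borel"
      using v(2) by measurable
    also have "(\<lambda>x. ennreal ((indicator A x * v x) powr p)) = (\<lambda>x. ennreal (v x powr p) * indicator A x)"
      using p by (auto simp: fun_eq_iff indicator_def)
    finally show ?thesis .
  qed
  note A [measurable]
  have "(\<integral>\<^sup>+x\<in>A. ennreal (u x powr p) \<partial>lborel)
    \<le> (\<integral>\<^sup>+x. ennreal (2 powr p) * (ennreal (v x powr p) * indicator A x + ennreal (k powr p) * indicator A x) \<partial>lborel)"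
  proof (rule nn_integral_mono)
    fix x
    have "u x powr p \<le> 2 powr p * (v x powr p + k powr p)" if "x \<in> A"
      using powr_mono2[of p "u x" "v x + k"] powr_add_le[of "v x" k p] u(1,2)[OF that] v(1)[OF that] p k by linarith
    then have "ennreal (u x powr p) \<le> ennreal (2 powr p) * (ennreal (v x powr p) + ennreal (k powr p))" if "x \<in> A"
      using that by (simp add: ennreal_leI flip: ennreal_mult' ennreal_plus)
    then show "ennreal (u x powr p) * indicator A x
      \<le> ennreal (2 powr p) * (ennreal (v x powr p) * indicator A x + ennreal (k powr p) * indicator A x)"
      by (auto simp: indicator_def)
  qed
  also have "\<dots> = ennreal (2 powr p) * ((\<integral>\<^sup>+x\<in>A. ennreal (v x powr p) \<partial>lborel) + ennreal (k powr p) * emeasure lborel A)"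
    using A by (simp add: nn_integral_cmult nn_integral_add)
  finally show ?thesis .
qed

lemma hardy_space_add_const:
  assumes f: "f \<in> hardy_space p" and p: "p > 0"
  shows "(\<lambda>z. f z + c) \<in> hardy_space p"
proof -
  define I where "I f r = (\<integral>\<^sup>+\<theta>\<in>{0..2*pi}. ennreal (cmod (f (of_real r * exp (\<i> * of_real \<theta>))) powr p) \<partial>lborel)"
    for f and r :: real
  have holo: "f holomorphic_on ball 0 1" and fin: "(SUP r\<in>{0<..<1}. I f r) < \<infinity>"
    using f by (auto simp: hardy_space_def I_def)
  have "I (\<lambda>z. f z + c) r \<le> ennreal (2 powr p) * ((SUP r\<in>{0<..<1}. I f r) + ennreal (cmod c powr p) * ennreal (2 * pi))"
    if r: "r \<in> {0<..<1}" for r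
  proof -
    have "(\<lambda>\<theta>. cmod (f (of_real r * exp (\<i> * of_real \<theta>)))) \<in> borel_measurable borel"
      by (intro borel_measurable_continuous_onI continuous_intros continuous_on_compose2[OF holomorphic_on_imp_continuous_on[OF holo]])
         (use r in \<open>auto simp: norm_mult\<close>)
    then have "I (\<lambda>z. f z + c) r \<le> ennreal (2 powr p) * (I f r + ennreal (cmod c powr p) * emeasure lborel {0..2*pi})"
      unfolding I_def by (intro nn_integral_powr_le_of_add_const p) (auto intro: norm_triangle_ineq)
    also have "\<dots> \<le> ennreal (2 powr p) * ((SUP r\<in>{0<..<1}. I f r) + ennreal (cmod c powr p) * ennreal (2 * pi))"
      using SUP_upper[OF r, of "I f"] by (intro mult_left_mono add_mono) auto
    finally show ?thesis .
  qed
  then have "(SUP r\<in>{0<..<1}. I (\<lambda>z. f z + c) r) \<le> ennreal (2 powr p) * ((SUP r\<in>{0<..<1}. I f r) + ennreal (cmod c powr p) * ennreal (2 * pi))"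
    by (rule SUP_least)
  also have "\<dots> < \<infinity>" using fin by (simp add: ennreal_mult_less_top)
  finally show ?thesis
    using holo by (auto simp: hardy_space_def I_def intro!: holomorphic_intros)
qed

lemma max_modulus_integral_add_const:
  assumes f: "f holomorphic_on ball 0 1" and p: "p > 0"
    and fin: "(\<integral>\<^sup>+r\<in>{0<..<1}. ennreal (max_modulus f r powr p) \<partial>lborel) < \<infinity>"
  shows "(\<integral>\<^sup>+r\<in>{0<..<1}. ennreal (max_modulus (\<lambda>z. f z + c) r powr p) \<partial>lborel) < \<infinity>"
proof -
  have f': "(\<lambda>z. f z + c) holomorphic_on ball 0 1" by (intro holomorphic_intros f)
  have "max_modulus (\<lambda>z. f z + c) r \<le> max_modulus f r + cmod c" if r: "r \<in> {0<..<1}" for r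
  proof -
    obtain w where "cmod w \<le> r" "cmod (f w + c) = max_modulus (\<lambda>z. f z + c) r"
      by (rule max_modulus_attained[OF f', of r]) (use r in auto)
    then show ?thesis
      using norm_le_max_modulus[OF f, of w r] norm_triangle_ineq[of "f w" c] r by auto
  qed
  then have "(\<integral>\<^sup>+r\<in>{0<..<1}. ennreal (max_modulus (\<lambda>z. f z + c) r powr p) \<partial>lborel)
    \<le> ennreal (2 powr p) * ((\<integral>\<^sup>+r\<in>{0<..<1}. ennreal (max_modulus f r powr p) \<partial>lborel)
        + ennreal (cmod c powr p) * emeasure lborel {0<..<1::real})"
    by (intro nn_integral_powr_le_of_add_const p borel_measurable_max_modulus f max_modulus_nonneg f') auto
  also have "\<dots> < \<infinity>" using fin by (simp add: ennreal_mult_less_top)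
  finally show ?thesis .
qed

text \<open>Subtracting \<open>f 0\<close> affects the finiteness of neither side, and makes \<open>f z / z\<close> a
holomorphic function without zeros.\<close>

theorem univalent_hardy_iff_max_modulus:
  fixes f :: "complex \<Rightarrow> complex" and p :: real
  assumes f: "f holomorphic_on ball 0 1" "inj_on f (ball 0 1)" and p: "p > 0"
  shows "f \<in> hardy_space p \<longleftrightarrow> (\<integral>\<^sup>+r\<in>{0<..<1}. ennreal (max_modulus f r powr p) \<partial>lborel) < \<infinity>"
proof -
  define g where "g z = f z + - f 0" for z
  have g: "g holomorphic_on ball 0 1" "inj_on g (ball 0 1)" "g 0 = 0"
    unfolding g_def[abs_def] using f by (auto simp: inj_on_def intro!: holomorphic_intros)
  have "f \<in> hardy_space p \<longleftrightarrow> g \<in> hardy_space p"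
    using hardy_space_add_const[of f p "- f 0"] hardy_space_add_const[of g p "f 0"] p
    by (auto simp: g_def[abs_def])
  also have "\<dots> \<longleftrightarrow> (\<integral>\<^sup>+r\<in>{0<..<1}. ennreal (max_modulus g r powr p) \<partial>lborel) < \<infinity>"
    by (rule univalent_hardy_iff_max_modulus_normalised[OF g p])
  also have "\<dots> \<longleftrightarrow> (\<integral>\<^sup>+r\<in>{0<..<1}. ennreal (max_modulus f r powr p) \<partial>lborel) < \<infinity>"
    using max_modulus_integral_add_const[OF f(1) p, of "- f 0"] max_modulus_integral_add_const[OF g(1) p, of "f 0"]
    by (auto simp: g_def[abs_def])
  finally show ?thesis .
qed

section \<open>Level sets and hyperbolic distance\<close>

lemma exp_ereal_mono: "x \<le> y \<Longrightarrow> exp_ereal x \<le> exp_ereal y"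
  by (cases x; cases y) (auto simp: ennreal_leI)

lemma exp_minus_hyp_dist_0:
  assumes "cmod w < 1"
  shows "exp (- hyp_dist 0 w) = (1 - cmod w) / (1 + cmod w)"
proof -
  have "(1 + cmod w) / (1 - cmod w) > 0" using assms by (intro divide_pos_pos) (auto simp: add_pos_nonneg)
  then show ?thesis by (simp add: hyp_dist_def exp_minus)
qed

text \<open>At the origin the hyperbolic distance is \<open>ln ((1 + \<bar>w\<bar>) / (1 - \<bar>w\<bar>))\<close>, so taking
exponentials replaces the extended-real infimum by a supremum of explicit numbers; the empty set
gives 0 on both sides.\<close>

lemma exp_ereal_minus_hyp_dist_set_0:
  assumes F: "F \<subseteq> unit_disc"
  shows "exp_ereal (- hyp_dist_set 0 F) = (SUP w\<in>F. ennreal ((1 - cmod w) / (1 + cmod w)))"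
proof (rule antisym)
  show "(SUP w\<in>F. ennreal ((1 - cmod w) / (1 + cmod w))) \<le> exp_ereal (- hyp_dist_set 0 F)"
  proof (rule SUP_least)
    fix w assume w: "w \<in> F"
    then have "hyp_dist_set 0 F \<le> ereal (hyp_dist 0 w)" unfolding hyp_dist_set_def by (rule INF_lower)
    then have "exp_ereal (ereal (- hyp_dist 0 w)) \<le> exp_ereal (- hyp_dist_set 0 F)"
      by (intro exp_ereal_mono) (metis ereal_minus_le_minus uminus_ereal.simps(1))
    then show "ennreal ((1 - cmod w) / (1 + cmod w)) \<le> exp_ereal (- hyp_dist_set 0 F)"
      using exp_minus_hyp_dist_0[of w] w F by auto
  qed
  show "exp_ereal (- hyp_dist_set 0 F) \<le> (SUP w\<in>F. ennreal ((1 - cmod w) / (1 + cmod w)))"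
  proof (cases "F = {}")
    case False
    then obtain w0 where w0: "w0 \<in> F" by blast
    let ?s = "SUP w\<in>F. ennreal ((1 - cmod w) / (1 + cmod w))"
    show ?thesis
    proof (cases ?s)
      case (real b)
      have le: "(1 - cmod w) / (1 + cmod w) \<le> b" if "w \<in> F" for w
        using SUP_upper[OF that, of "\<lambda>w. ennreal ((1 - cmod w) / (1 + cmod w))"] real by (simp add: ennreal_le_iff)
      have pos: "(1 - cmod w) / (1 + cmod w) > 0" if "w \<in> F" for w
        using that F by (intro divide_pos_pos) (auto simp: add_pos_nonneg)
      have b: "b > 0" using le[OF w0] pos[OF w0] by linarith
      have "ereal (- ln b) \<le> hyp_dist_set 0 F"
        unfolding hyp_dist_set_def
      proof (rule INF_greatest)
        fix w assume w: "w \<in> F"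
        then have "exp (- hyp_dist 0 w) \<le> b" using le[OF w] exp_minus_hyp_dist_0[of w] F by auto
        then have "- hyp_dist 0 w \<le> ln b" using b by (simp add: ln_ge_iff)
        then show "ereal (- ln b) \<le> ereal (hyp_dist 0 w)" by simp
      qed
      then have "- hyp_dist_set 0 F \<le> ereal (ln b)"
        by (metis ereal_minus_le_minus ereal_uminus_uminus uminus_ereal.simps(1))
      then have "exp_ereal (- hyp_dist_set 0 F) \<le> exp_ereal (ereal (ln b))" by (rule exp_ereal_mono)
      then show ?thesis using b real by simp
    next
      case top
      then show ?thesis by (simp only: top_greatest)
    qed
  qed simp
qed

text \<open>As the maximum modulus increases with the radius, for levels above \<open>\<bar>f 0\<bar>\<close> this length is the
distance to the unit circle of the point of the level set closest to the origin (0 if the level set is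
empty). It is therefore comparable with \<open>exp (- d (0, F\<^sub>\<alpha>))\<close>, and unlike the latter it is visibly
measurable in \<open>\<alpha>\<close> and open to an exchange of integrals.\<close>

definition superlevel_measure :: "(complex \<Rightarrow> complex) \<Rightarrow> real \<Rightarrow> ennreal"
  where "superlevel_measure f \<alpha> = emeasure lborel {r \<in> {0<..<1}. \<alpha> \<le> max_modulus f r}"

lemma superlevel_radii_borel:
  assumes "f holomorphic_on ball 0 1"
  shows "{r \<in> {0<..<1}. \<alpha> \<le> max_modulus f r} \<in> sets borel"
proof -
  have "{r \<in> {0<..<1}. \<alpha> \<le> max_modulus f r} = {0<..<1} \<inter> (\<lambda>r. indicator {0<..<1} r * max_modulus f r) -` {\<alpha>..}"
    by auto
  then show ?thesis
    using measurable_sets_borel[OF borel_measurable_max_modulus[OF assms], of "{\<alpha>..}"] by simp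
qed

lemma exp_minus_dist_level_set_le:
  assumes f: "f holomorphic_on ball 0 1"
  shows "exp_ereal (- hyp_dist_set 0 (level_set f \<alpha>)) \<le> superlevel_measure f \<alpha>"
proof -
  have "ennreal ((1 - cmod w) / (1 + cmod w)) \<le> superlevel_measure f \<alpha>" if "w \<in> level_set f \<alpha>" for w
  proof -
    have w: "cmod w < 1" "cmod (f w) = \<alpha>" using that by (auto simp: level_set_def)
    have "(1 - cmod w) / (1 + cmod w) \<le> 1 - cmod w"
      using w by (simp add: divide_le_eq add_pos_nonneg mult_le_cancel_left1)
    then have "ennreal ((1 - cmod w) / (1 + cmod w)) \<le> emeasure lborel {cmod w<..<1}"
      using w by (simp add: ennreal_leI)
    also have "\<dots> \<le> superlevel_measure f \<alpha>"
      unfolding superlevel_measure_def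
    proof (rule emeasure_mono)
      show "{cmod w<..<1} \<subseteq> {r \<in> {0<..<1}. \<alpha> \<le> max_modulus f r}"
        using norm_le_max_modulus[OF f, of w] w(2) le_less_trans[OF norm_ge_zero] by auto
    qed (use superlevel_radii_borel[OF f] in simp)
    finally show ?thesis .
  qed
  moreover have "level_set f \<alpha> \<subseteq> unit_disc" by (auto simp: level_set_def)
  ultimately show ?thesis by (simp add: exp_ereal_minus_hyp_dist_set_0 SUP_le_iff)
qed

text \<open>If the maximum modulus has reached \<open>\<alpha>\<close> at radius \<open>r\<close>, then by connectedness the level set
meets the disc of radius \<open>r\<close>. The lower bound on \<open>\<alpha>\<close> enters here: a level below \<open>\<bar>f 0\<bar>\<close> is
exceeded at every radius, although the level set may be far away or empty.\<close>

lemma superlevel_measure_le_exp_minus_dist: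
  assumes f: "f holomorphic_on ball 0 1" and \<alpha>: "cmod (f 0) \<le> \<alpha>"
  shows "ennreal (1/2) * superlevel_measure f \<alpha> \<le> exp_ereal (- hyp_dist_set 0 (level_set f \<alpha>))"
proof (cases "exp_ereal (- hyp_dist_set 0 (level_set f \<alpha>))")
  case (real g)
  have sub: "level_set f \<alpha> \<subseteq> unit_disc" by (auto simp: level_set_def)
  have "1 - 2 * g \<le> r" if r: "r \<in> {0<..<1}" "\<alpha> \<le> max_modulus f r" for r
  proof -
    obtain z where z: "cmod z \<le> r" "cmod (f z) = max_modulus f r"
      by (rule max_modulus_attained[OF f, of r]) (use r in auto)
    have "connected ((\<lambda>z. cmod (f z)) ` cball 0 r)"
      using r by (intro connected_continuous_image continuous_intros
          continuous_on_subset[OF holomorphic_on_imp_continuous_on[OF f]]) auto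
    moreover have "cmod (f 0) \<in> (\<lambda>z. cmod (f z)) ` cball 0 r" "max_modulus f r \<in> (\<lambda>z. cmod (f z)) ` cball 0 r"
      using r z by (auto intro!: image_eqI[of _ _ z])
    ultimately have "\<alpha> \<in> (\<lambda>z. cmod (f z)) ` cball 0 r"
      using \<alpha> r(2) by (rule connectedD_interval)
    then obtain w where w: "cmod w \<le> r" "cmod (f w) = \<alpha>" by auto
    then have "w \<in> level_set f \<alpha>" using r by (auto simp: level_set_def)
    then have "ennreal ((1 - cmod w) / (1 + cmod w)) \<le> ennreal g"
      unfolding real(2)[symmetric] exp_ereal_minus_hyp_dist_set_0[OF sub] by (rule SUP_upper)
    then have "(1 - cmod w) / (1 + cmod w) \<le> g" using real by (simp add: ennreal_le_iff)
    moreover have "(1 - r) / 2 \<le> (1 - cmod w) / (1 + cmod w)"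
      using w r by (intro frac_le) (auto simp: add_pos_nonneg)
    ultimately have "(1 - r) / 2 \<le> g" by (rule order_trans[rotated])
    then show ?thesis by simp
  qed
  then have "superlevel_measure f \<alpha> \<le> emeasure lborel {1 - 2 * g..1}"
    unfolding superlevel_measure_def by (intro emeasure_mono) auto
  also have "\<dots> = ennreal (2 * g)" using real by simp
  finally have "ennreal (1/2) * superlevel_measure f \<alpha> \<le> ennreal (1/2) * ennreal (2 * g)"
    by (rule mult_left_mono) simp
  also have "\<dots> = ennreal (1/2 * (2 * g))" by (rule ennreal_mult'[symmetric]) simp
  also have "\<dots> = ennreal g" by simp
  finally show ?thesis using real by simp
qed simp

text \<open>Tonelli's theorem on the region \<open>\<alpha> \<le> max_modulus f r\<close>.\<close>

lemma superlevel_measure_layer_cake: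
  assumes f: "f holomorphic_on ball 0 1" and p: "p > 0"
  shows "superlevel_measure f \<in> borel_measurable borel"
    and "(\<integral>\<^sup>+\<alpha>\<in>{0<..}. ennreal (\<alpha> powr (p - 1)) * superlevel_measure f \<alpha> \<partial>lborel)
       = ennreal (1 / p) * (\<integral>\<^sup>+r\<in>{0<..<1}. ennreal (max_modulus f r powr p) \<partial>lborel)"
proof -
  define n where "n r = indicator {0<..<1} r * max_modulus f r" for r :: real
  have n [measurable]: "n \<in> borel_measurable borel"
    unfolding n_def[abs_def] by (rule borel_measurable_max_modulus[OF f])
  define J :: "real \<Rightarrow> real \<Rightarrow> ennreal" where "J \<alpha> r = indicator {0<..<1} r * (if \<alpha> \<le> n r then 1 else 0)" for \<alpha> r
  have J: "superlevel_measure f \<alpha> = (\<integral>\<^sup>+r. J \<alpha> r \<partial>lborel)" for \<alpha>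
  proof -
    have "(\<integral>\<^sup>+r. J \<alpha> r \<partial>lborel) = (\<integral>\<^sup>+r. indicator {r \<in> {0<..<1}. \<alpha> \<le> max_modulus f r} r \<partial>lborel)"
      by (intro nn_integral_cong) (auto simp: J_def n_def indicator_def)
    also have "\<dots> = superlevel_measure f \<alpha>"
      unfolding superlevel_measure_def using superlevel_radii_borel[OF f] by (intro nn_integral_indicator) simp
    finally show ?thesis by simp
  qed
  have [measurable]: "case_prod J \<in> borel_measurable (borel \<Otimes>\<^sub>M borel)"
    unfolding J_def[abs_def] case_prod_beta by measurable
  show meas: "superlevel_measure f \<in> borel_measurable borel"
    unfolding J[abs_def] by measurable
  have "(\<integral>\<^sup>+\<alpha>\<in>{0<..}. ennreal (\<alpha> powr (p - 1)) * superlevel_measure f \<alpha> \<partial>lborel)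
     = (\<integral>\<^sup>+\<alpha>. (\<integral>\<^sup>+r. ennreal (\<alpha> powr (p - 1)) * indicator {0<..} \<alpha> * J \<alpha> r \<partial>lborel) \<partial>lborel)"
    unfolding J by (intro nn_integral_cong, subst nn_integral_cmult) (auto simp: mult_ac)
  also have "\<dots> = (\<integral>\<^sup>+r. (\<integral>\<^sup>+\<alpha>. ennreal (\<alpha> powr (p - 1)) * indicator {0<..} \<alpha> * J \<alpha> r \<partial>lborel) \<partial>lborel)"
    by (rule lborel_pair.Fubini'[symmetric]) measurable
  also have "\<dots> = (\<integral>\<^sup>+r. ennreal (1 / p) * (ennreal (n r powr p) * indicator {0<..<1} r) \<partial>lborel)"
  proof (intro nn_integral_cong)
    fix r :: real
    show "(\<integral>\<^sup>+\<alpha>. ennreal (\<alpha> powr (p - 1)) * indicator {0<..} \<alpha> * J \<alpha> r \<partial>lborel)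
       = ennreal (1 / p) * (ennreal (n r powr p) * indicator {0<..<1} r)"
    proof (cases "r \<in> {0<..<1}")
      case True
      have n0: "0 \<le> n r" using True max_modulus_nonneg[OF f, of r] by (simp add: n_def)
      have "(\<integral>\<^sup>+\<alpha>. ennreal (\<alpha> powr (p - 1)) * indicator {0<..} \<alpha> * J \<alpha> r \<partial>lborel)
         = (\<integral>\<^sup>+\<alpha>\<in>{0<..<n r}. ennreal (\<alpha> powr (p - 1)) \<partial>lborel)"
        by (intro nn_integral_cong_AE eventually_mono[OF AE_lborel_singleton[of "n r"]])
           (use True in \<open>auto simp: J_def indicator_def\<close>)
      also have "\<dots> = ennreal (n r powr p / p)" by (rule nn_integral_powr[OF p n0])
      finally show ?thesis using True p by (simp add: divide_inverse mult.commute flip: ennreal_mult')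
    qed (simp add: J_def)
  qed
  also have "\<dots> = ennreal (1 / p) * (\<integral>\<^sup>+r\<in>{0<..<1}. ennreal (n r powr p) \<partial>lborel)"
    by (rule nn_integral_cmult) measurable
  also have "(\<integral>\<^sup>+r\<in>{0<..<1}. ennreal (n r powr p) \<partial>lborel) = (\<integral>\<^sup>+r\<in>{0<..<1}. ennreal (max_modulus f r powr p) \<partial>lborel)"
    by (intro nn_integral_cong) (auto simp: n_def indicator_def)
  finally show "(\<integral>\<^sup>+\<alpha>\<in>{0<..}. ennreal (\<alpha> powr (p - 1)) * superlevel_measure f \<alpha> \<partial>lborel)
       = ennreal (1 / p) * (\<integral>\<^sup>+r\<in>{0<..<1}. ennreal (max_modulus f r powr p) \<partial>lborel)" .
qed

text \<open>The two integrands are comparable for \<open>\<alpha> \<ge> \<bar>f 0\<bar>\<close>, and on the remaining bounded range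
\<open>\<alpha> powr (p - 1)\<close> is integrable because \<open>p > 0\<close>. Additivity and homogeneity of the integral require
measurable integrands, so they are applied to \<open>superlevel_measure f\<close>, and the function
\<open>\<alpha> \<mapsto> exp_ereal (- hyp_dist_set 0 (level_set f \<alpha>))\<close> enters through monotonicity alone.\<close>

lemma hyp_dist_integral_finite_iff:
  fixes f :: "complex \<Rightarrow> complex" and p :: real
  assumes f: "f holomorphic_on ball 0 1" and p: "p > 0"
  shows "(\<integral>\<^sup>+\<alpha>\<in>{0<..}. ennreal (\<alpha> powr (p - 1)) * exp_ereal (- hyp_dist_set 0 (level_set f \<alpha>)) \<partial>lborel) < \<infinity>
    \<longleftrightarrow> (\<integral>\<^sup>+r\<in>{0<..<1}. ennreal (max_modulus f r powr p) \<partial>lborel) < \<infinity>"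
proof -
  define L where "L = (\<integral>\<^sup>+\<alpha>\<in>{0<..}. ennreal (\<alpha> powr (p - 1)) * superlevel_measure f \<alpha> \<partial>lborel)"
  define G where "G = (\<integral>\<^sup>+\<alpha>\<in>{0<..}. ennreal (\<alpha> powr (p - 1)) * exp_ereal (- hyp_dist_set 0 (level_set f \<alpha>)) \<partial>lborel)"
  define m where "m = cmod (f 0)"
  have [measurable]: "superlevel_measure f \<in> borel_measurable borel" by (rule superlevel_measure_layer_cake[OF f p])
  have GL: "G \<le> L"
    unfolding G_def L_def
    by (intro nn_integral_mono mult_right_mono mult_left_mono exp_minus_dist_level_set_le[OF f]) auto
  have "L \<le> ennreal (m powr p / p) + 2 * G"
  proof -
    have "superlevel_measure f \<alpha> \<le> 1" for \<alpha>
    proof -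
      have "superlevel_measure f \<alpha> \<le> emeasure lborel {0<..<1::real}"
        unfolding superlevel_measure_def by (intro emeasure_mono) auto
      then show ?thesis by simp
    qed
    \<comment> \<open>The factor \<open>2 * (1/2)\<close> leaves the half inside the integral, where the comparison needs it.\<close>
    then have "L \<le> (\<integral>\<^sup>+\<alpha>. ennreal (\<alpha> powr (p - 1)) * indicator {0<..<m} \<alpha>
        + 2 * (ennreal (\<alpha> powr (p - 1)) * (ennreal (1/2) * superlevel_measure f \<alpha>) * indicator {0<..} \<alpha> * indicator {m..} \<alpha>) \<partial>lborel)"
      unfolding L_def
    proof (intro nn_integral_mono)
      fix \<alpha> :: real
      assume le: "\<And>\<alpha>. superlevel_measure f \<alpha> \<le> 1"
      have "2 * (x * (ennreal (1/2) * y)) = x * y" for x y :: ennreal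
      proof -
        have "2 * ennreal (1/2) = ennreal (2 * (1/2))" by (simp only: ennreal_mult' ennreal_numeral zero_le_numeral)
        then have "2 * ennreal (1/2) = 1" by simp
        moreover have "2 * (x * (ennreal (1/2) * y)) = (2 * ennreal (1/2)) * (x * y)" by (simp only: mult_ac)
        ultimately show ?thesis by simp
      qed
      then show "ennreal (\<alpha> powr (p - 1)) * superlevel_measure f \<alpha> * indicator {0<..} \<alpha>
        \<le> ennreal (\<alpha> powr (p - 1)) * indicator {0<..<m} \<alpha>
        + 2 * (ennreal (\<alpha> powr (p - 1)) * (ennreal (1/2) * superlevel_measure f \<alpha>) * indicator {0<..} \<alpha> * indicator {m..} \<alpha>)"
        using mult_left_mono[OF le[of \<alpha>], of "ennreal (\<alpha> powr (p - 1))"]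
        by (auto simp: indicator_def not_le not_less)
    qed
    also have "\<dots> = (\<integral>\<^sup>+\<alpha>\<in>{0<..<m}. ennreal (\<alpha> powr (p - 1)) \<partial>lborel)
      + 2 * (\<integral>\<^sup>+\<alpha>. ennreal (\<alpha> powr (p - 1)) * (ennreal (1/2) * superlevel_measure f \<alpha>) * indicator {0<..} \<alpha> * indicator {m..} \<alpha> \<partial>lborel)"
      by (subst nn_integral_add) (auto simp: nn_integral_cmult)
    also have "\<dots> \<le> ennreal (m powr p / p) + 2 * G"
    proof (intro add_mono mult_left_mono)
      show "(\<integral>\<^sup>+\<alpha>\<in>{0<..<m}. ennreal (\<alpha> powr (p - 1)) \<partial>lborel) \<le> ennreal (m powr p / p)"
        using nn_integral_powr[OF p, of m] by (simp add: m_def)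
      show "(\<integral>\<^sup>+\<alpha>. ennreal (\<alpha> powr (p - 1)) * (ennreal (1/2) * superlevel_measure f \<alpha>) * indicator {0<..} \<alpha> * indicator {m..} \<alpha> \<partial>lborel) \<le> G"
        unfolding G_def
      proof (rule nn_integral_mono)
        fix \<alpha> :: real
        show "ennreal (\<alpha> powr (p - 1)) * (ennreal (1/2) * superlevel_measure f \<alpha>) * indicator {0<..} \<alpha> * indicator {m..} \<alpha>
          \<le> ennreal (\<alpha> powr (p - 1)) * exp_ereal (- hyp_dist_set 0 (level_set f \<alpha>)) * indicator {0<..} \<alpha>"
          using superlevel_measure_le_exp_minus_dist[OF f, of \<alpha>]
          by (auto simp: indicator_def m_def intro!: mult_left_mono)
      qed
    qed auto
    finally show ?thesis .
  qed
  moreover have "ennreal (m powr p / p) + 2 * G < \<infinity>" if "G < \<infinity>"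
    using that by (simp add: ennreal_mult_less_top)
  ultimately have "G < \<infinity> \<longleftrightarrow> L < \<infinity>"
    using GL le_less_trans by metis
  also have "\<dots> \<longleftrightarrow> (\<integral>\<^sup>+r\<in>{0<..<1}. ennreal (max_modulus f r powr p) \<partial>lborel) < \<infinity>"
    unfolding L_def superlevel_measure_layer_cake(2)[OF f p] using p by (auto simp: ennreal_mult_less_top)
  finally show ?thesis by (simp add: G_def)
qed

theorem theorem1p1:
  fixes \<psi> :: "complex \<Rightarrow> complex" and D :: "complex set" and p :: real
  assumes "open D" and "connected D" and "simply_connected D" and "\<not> bounded D"
    and "conformal_map \<psi> D"
    and "0 < p"
  shows "\<psi> \<in> hardy_space p \<longleftrightarrow>
    (\<integral>\<^sup>+\<alpha>\<in>{0<..}. ennreal (\<alpha> powr (p - 1)) * exp_ereal (- hyp_dist_set 0 (level_set \<psi> \<alpha>)) \<partial>lborel) < \<infinity>"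
proof -
  have "\<psi> holomorphic_on ball 0 1" "inj_on \<psi> (ball 0 1)"
    using assms by (auto simp: conformal_map_def)
  then show ?thesis
    using univalent_hardy_iff_max_modulus[of \<psi> p] hyp_dist_integral_finite_iff[of \<psi> p] \<open>0 < p\<close> by simp
qed

end
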